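(* Let $r\in\{1,2\}$, let $\gamma_d$ be the instantaneous SNR of the destination link with the law defined in the context, let $\gamma^{*}>0$ be a threshold, and let $\mathrm{OP}=\Pr[\gamma_d\le\gamma^{*}]$ be the outage probability. Then $$\mathrm{OP}=\frac{\Lambda_{3,d}}{\sqrt r\,\mu_{r,d}^{l_d/r}}\,(\gamma^{*})^{\frac{l_d}{r}}\,G_{1,r+1}^{r,1}\left[\Lambda_{4,d}\frac{\gamma^{*}}{\mu_{r,d}}\,\middle|\,\begin{array}{c}1-\frac{l_d}{r}\\ 0,\frac{r-1}{r},-\frac{l_d}{r}\end{array}\right],$$ and at high SNR, i.e. as $\mu_{r,d}\to\infty$ with $r$, $l_d$, $\gamma^{*}$, $\Lambda_{3,d}$, $\Lambda_{4,d}$ fixed, $\mathrm{OP}\approx\mathrm{OP}^{\infty}$ in the sense that $\mathrm{OP}/\mathrm{OP}^{\infty}\to1$, where $$\mathrm{OP}^{\infty}=\sum_{h=1}^{r}\frac{\Lambda_{3,d}}{\sqrt r\,\Lambda_{4,d}^{t_{1,h}-1}}\left(\frac{\gamma^{*}}{\mu_{r,d}}\right)^{\frac{l_d}{r}-t_{1,h}+1}\frac{\prod_{g=1,\,g\ne h}^{r}\Gamma(t_{1,h}-t_{1,g})\;\Gamma\left(1+\frac{l_d}{r}-t_{1,h}\right)}{\Gamma(1+t_{1,r+1}-t_{1,h})}$$ and $t_1=(t_{1,1},\dots,t_{1,r+1})$ is $(1,1+l_d)$ if $r=1$ and $(1,\tfrac12,1+\tfrac{l_d}{2})$ if $r=2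$.
   Context: Meijer's G function: $G^{m,n}_{p,q}\left[z\,\middle|\,\begin{array}{c}a_1,\dots,a_p\\ b_1,\dots,b_q\end{array}\right]=\frac{1}{2\pi i}\int_{L}\frac{\prod_{i=1}^{m}\Gamma(b_i+s)\prod_{i=1}^{n}\Gamma(1-a_i-s)}{\prod_{i=n+1}^{p}\Gamma(a_i+s)\prod_{i=m+1}^{q}\Gamma(1-b_i-s)}z^{-s}\,ds$, where $L$ separates the poles of the $\Gamma(b_i+s)$ ($i\le m$) from those of the $\Gamma(1-a_i-s)$ ($i\le n$). In a parameter list, "$0,\frac{r-1}{r}$" denotes the single entry $0$ if $r=1$, and $0,\frac12$ if $r=2$. Model. $M$ is a positive random variable (the two-hop channel gain through one reflecting element of the reconfigurable intelligent surface: a product of two independent inverted Gamma-Gamma turbulence variables with pointing errors) with mean $E=\mathbb{E}(M)>0$ and variance $0<\mathrm{Var}(M)<\infty$; only $E$ and $\mathrm{Var}(M)$ enter. $N_d\ge1$ is the number of reflecting elements, $l_d=N_dE^2/\mathrm{Var}(M)$, $k_d=\mathrm{Var}(M)/E$. The sum of the $N_d$ gains is modelled by $\bar M_d$ with density $\frac{y^{l_d-1}}{\Gamma(l_d)k_d^{l_d}}e^{-y/k_d}$, $y>0$. The instantaneous SNR is $\gamma_d=\mu_{r,d}(\bar M_d/E)^r$, where $\mu_{r,d}>0$ is the electrical SNR and $r$ is the detection type ($r=1$ heterodyne, $r=2$ intensity modulation/direct detection). Constants: $\Lambda_{3,d}=\frac{E^{l_d}}{\Gamma(l_d)k_d^{l_d}(2\pi)^{(r-1)/2}}$,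 $\Lambda_{4,d}=\left[\frac{E}{k_dr}\right]^r$. *)

theory Defs
  imports "HOL-Complex_Analysis.Complex_Analysis" "HOL-Probability.Probability"
begin

section \<open>Meijer's G function\<close>

text \<open>
  Parameter lists are 0-based: \<open>a ! i\<close> is $a_{i+1}$; it is understood that
  \<open>m \<le> length b = q\<close> and \<open>n \<le> length a = p\<close>.  The library's
  \<open>Gamma\<close> is 0 at its poles, so a quotient by it vanishes there, as \<open>1/\<Gamma>\<close> does.
\<close>

definition meijer_integrand ::
    "nat \<Rightarrow> nat \<Rightarrow> complex list \<Rightarrow> complex list \<Rightarrow> complex \<Rightarrow> complex \<Rightarrow> complex" where
  "meijer_integrand m n a b z s =
     ((\<Prod>i<m. Gamma (b ! i + s)) * (\<Prod>i<n. Gamma (1 - a ! i - s))) /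
     ((\<Prod>i=n..<length a. Gamma (a ! i + s)) * (\<Prod>i=m..<length b. Gamma (1 - b ! i - s)))
     * z powr (- s)"

text \<open>Simple piecewise smooth curves from \<open>c - \<i>\<infinity>\<close> to \<open>c + \<i>\<infinity>\<close>, straight near both ends.\<close>

definition upward_contour :: "(real \<Rightarrow> complex) \<Rightarrow> bool" where
  "upward_contour L \<longleftrightarrow>
     inj L \<and> (\<forall>R>0. L piecewise_C1_differentiable_on {-R..R}) \<and>
     (\<exists>c T. \<forall>t. \<bar>t\<bar> \<ge> T \<longrightarrow> L t = Complex c t)"

text \<open>
  Seen from a point to the left (right) of such a curve, the curve makes a half turn
  counterclockwise (clockwise).
\<close>

definition index_along :: "(real \<Rightarrow> complex) \<Rightarrow> complex \<Rightarrow> complex \<Rightarrow> bool" where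
  "index_along L p w \<longleftrightarrow>
     p \<notin> range L \<and> ((\<lambda>R. winding_number (\<lambda>u. L ((2 * u - 1) * R)) p) \<longlongrightarrow> w) at_top"

definition left_of :: "(real \<Rightarrow> complex) \<Rightarrow> complex \<Rightarrow> bool" where
  "left_of L p \<longleftrightarrow> index_along L p (1/2)"

definition right_of :: "(real \<Rightarrow> complex) \<Rightarrow> complex \<Rightarrow> bool" where
  "right_of L p \<longleftrightarrow> index_along L p (-1/2)"

definition meijer_contour ::
    "nat \<Rightarrow> nat \<Rightarrow> complex list \<Rightarrow> complex list \<Rightarrow> (real \<Rightarrow> complex) \<Rightarrow> bool" where
  "meijer_contour m n a b L \<longleftrightarrow>
     upward_contour L \<and>
     (\<forall>i<m. \<forall>p. is_pole (\<lambda>s. Gamma (b ! i + s)) p \<longrightarrow> left_of L p) \<and>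
     (\<forall>i<n. \<forall>p. is_pole (\<lambda>s. Gamma (1 - a ! i - s)) p \<longrightarrow> right_of L p)"

text \<open>By Cauchy's theorem the value does not depend on which separating contour is chosen.\<close>

definition meijer_G ::
    "nat \<Rightarrow> nat \<Rightarrow> complex list \<Rightarrow> complex list \<Rightarrow> complex \<Rightarrow> complex" where
  "meijer_G m n a b z =
     (let L = (SOME L. meijer_contour m n a b L) in
      1 / (2 * of_real pi * \<i>) *
      integral UNIV (\<lambda>t. meijer_integrand m n a b z (L t) * vector_derivative L (at t)))"


section \<open>The destination link\<close>

definition gamma_density :: "real \<Rightarrow> real \<Rightarrow> real \<Rightarrow> real" where
  "gamma_density l k y =
     (if y > 0 then y powr (l - 1) / (Gamma l * k powr l) * exp (- y / k) else 0)"

definition snr :: "nat \<Rightarrow> real \<Rightarrow> real \<Rightarrow> real \<Rightarrow> real" where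
  "snr r E \<mu> x = \<mu> * (x / E) ^ r"

definition outage_prob ::
    "'b measure \<Rightarrow> ('b \<Rightarrow> real) \<Rightarrow> nat \<Rightarrow> real \<Rightarrow> real \<Rightarrow> real \<Rightarrow> real" where
  "outage_prob Q Mbar r E g \<mu> = \<P>(\<omega> in Q. snr r E \<mu> (Mbar \<omega>) \<le> g)"

text \<open>1-based: \<open>t1 r l h\<close> is $t_{1,h}$ for $1 \le h \le r+1$.\<close>

definition t1 :: "nat \<Rightarrow> real \<Rightarrow> nat \<Rightarrow> real" where
  "t1 r l h = (if r = 1 then [1, 1 + l] else [1, 1/2, 1 + l/2]) ! (h - 1)"

definition outage_prob_asymp ::
    "nat \<Rightarrow> real \<Rightarrow> real \<Rightarrow> real \<Rightarrow> real \<Rightarrow> real \<Rightarrow> real" where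
  "outage_prob_asymp r l \<Lambda>3 \<Lambda>4 g \<mu> =
     (\<Sum>h=1..r. \<Lambda>3 / (sqrt r * \<Lambda>4 powr (t1 r l h - 1)) *
        (g / \<mu>) powr (l / r - t1 r l h + 1) *
        ((\<Prod>g'\<in>{1..r} - {h}. Gamma (t1 r l h - t1 r l g')) * Gamma (1 + l / r - t1 r l h) /
         Gamma (1 + t1 r l (r + 1) - t1 r l h)))"

end

theory Submission
  imports Defs
begin

text \<open>
  On a separating contour the integrand of the $G$ function is, by $\Gamma(1+u) = u\,\Gamma(u)$ and, for $r = 2$,
  Legendre's duplication formula, a constant multiple of $\Gamma(rs)\,x^{-rs}/(l/r-s)$ with
  $x = (E/k)(\gamma^*/\mu)^{1/r}$.  Moving the contour to the line $\mathrm{Re}\,s = -(K+1/2)/r$ picks up the residues at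
  $s = -n/r$ for $n \le K$, and the integral over that line is $O(x^K/K!)$.  Hence for every admissible contour the
  $G$ function is the series $\sum_n (-1)^n x^n/(n!\,(l+n))$, which is $x^{-l}$ times the lower incomplete Gamma
  function, i.e. the distribution function of the Gamma law.  At $x = 0$ the series is $1/l$, which gives the asymptotics.
\<close>

section \<open>Truncations of an upward contour\<close>

text \<open>The obstacle is that \<open>meijer_G\<close> picks its contour by \<open>SOME\<close>:
  nothing is known of it except its straight ends and, for each pole, the limit of the winding
  numbers of its truncations. No loop is at hand, so residues are not collected by a closed contour.
  Instead finitely many polar parts c/(s - p) are subtracted from the integrand; the rest has a
  primitive and contributes endpoint values only, while each polar part contributes exactly the
  winding number that the separation hypothesis controls. For two contours the difference of the
  endpoint values tends to 0, because the integrand decays along the horizontal segments that join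
  them. The primitive lives on a convex domain, here a half-plane. It also contains the pole l/r of
  the other family, whose term drops out because both contours have it on their right. It contains
  only finitely many poles of the left family, hence one shift for each K and a limit in K. The
  offset 1/2 puts the line midway between two poles and makes \<Gamma>(1/2) = sqrt pi the constant
  of the estimate.\<close>

definition symm_arc :: "(real \<Rightarrow> complex) \<Rightarrow> real \<Rightarrow> real \<Rightarrow> complex" where
  "symm_arc L R u = L ((2 * u - 1) * R)"

lemma upward_contourD:
  assumes "upward_contour L"
  obtains c T where "T > 0" "\<And>t. \<bar>t\<bar> \<ge> T \<Longrightarrow> L t = Complex c t"
proof -
  from assms obtain c T where "\<And>t. \<bar>t\<bar> \<ge> T \<Longrightarrow> L t = Complex c t"
    unfolding upward_contour_def by blast
  thus ?thesis using that[of "max T 1" c] by simp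
qed

lemma valid_path_symm_arc:
  assumes "upward_contour L" "R > 0"
  shows   "valid_path (symm_arc L R)"
proof -
  have "(L \<circ> (\<lambda>u. (2 * R) *\<^sub>R u + (- R))) piecewise_C1_differentiable_on {0..1}"
  proof (rule piecewise_C1_differentiable_affine, rule piecewise_C1_differentiable_on_subset)
    show "L piecewise_C1_differentiable_on {-R..R}"
      using assms by (auto simp: upward_contour_def)
    show "(\<lambda>u. 2 * R * u + - R) ` {0..1} \<subseteq> {-R..R}"
    proof safe
      fix u :: real assume u: "u \<in> {0..1}"
      have "R * u \<le> R * 1" "0 \<le> R * u" using assms u by (auto intro!: mult_left_mono)
      thus "2 * R * u + - R \<in> {-R..R}" by auto
    qed
  qed
  also have "L \<circ> (\<lambda>u. (2 * R) *\<^sub>R u + (- R)) = symm_arc L R"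
    by (auto simp: symm_arc_def algebra_simps)
  finally show ?thesis by (simp add: valid_path_def)
qed

lemma path_image_symm_arc:
  assumes "R > 0" shows "path_image (symm_arc L R) = L ` {-R..R}"
proof -
  have "(\<lambda>u. (2 * u - 1) * R) ` {0..1} = {-R..R}"
  proof -
    have "(\<lambda>u. (2 * R) * u + (- R)) ` {0..1} = {-R..R}"
      using assms by (subst image_affinity_atLeastAtMost) auto
    thus ?thesis by (simp add: algebra_simps)
  qed
  hence "L ` {-R..R} = L ` (\<lambda>u. (2 * u - 1) * R) ` {0..1}" by simp
  thus ?thesis unfolding path_image_def symm_arc_def by (simp add: image_image)
qed

lemma pathstart_symm_arc [simp]: "pathstart (symm_arc L R) = L (-R)"
  and pathfinish_symm_arc [simp]: "pathfinish (symm_arc L R) = L R"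
  by (simp_all add: symm_arc_def pathstart_def pathfinish_def)

text \<open>Substitution t = (2u - 1) R. As an equivalence of \<open>has_integral\<close> statements
  it also carries existence in both directions, between integrals over {-R..R} and contour
  integrals.\<close>

lemma has_contour_integral_symm_arc:
  assumes "upward_contour L" "R > 0"
  shows   "(f has_contour_integral I) (symm_arc L R) \<longleftrightarrow>
             ((\<lambda>t. f (L t) * vector_derivative L (at t)) has_integral I) {-R..R}"
proof -
  define h where "h = (\<lambda>u::real. (2 * R) *\<^sub>R u + (-R))"
  have h: "h u = (2 * u - 1) * R" for u by (simp add: h_def algebra_simps)
  from assms have "L piecewise_C1_differentiable_on {-R..R}"
    by (auto simp: upward_contour_def)
  then obtain S where S: "finite S" "\<And>x. x \<in> {-R..R} - S \<Longrightarrow> L differentiable at x"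
    unfolding piecewise_C1_differentiable_on_def C1_differentiable_on_eq by auto
  \<comment> \<open>\<open>L\<close> may have corners at the points of \<open>S\<close>, where
    \<open>vector_derivative\<close> is a junk value; they pull back to finitely many parameters,
    which the spike rule discards.\<close>
  have fin: "finite (h -` S)"
  proof (rule finite_subset)
    show "h -` S \<subseteq> (\<lambda>t. (t + R) / (2 * R)) ` S"
    proof
      fix u assume "u \<in> h -` S"
      moreover have "u = (h u + R) / (2 * R)"
        using assms by (simp add: h_def field_simps)
      ultimately show "u \<in> (\<lambda>t. (t + R) / (2 * R)) ` S" by (intro image_eqI[of _ _ "h u"]) auto
    qed
    show "finite ((\<lambda>t. (t + R) / (2 * R)) ` S)" using S(1) by (rule finite_imageI)
  qed
  have vd: "vector_derivative (symm_arc L R) (at u) = (2 * R) *\<^sub>R vector_derivative L (at (h u))"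
    if "u \<in> {0..1} - h -` S" for u
  proof -
    have "R * u \<le> R * 1" "0 \<le> R * u" using assms that by (auto intro!: mult_left_mono)
    hence "h u \<in> {-R..R} - S" using that by (auto simp: h_def)
    hence "(L has_vector_derivative vector_derivative L (at (h u))) (at (h u))"
      using S vector_derivative_works by blast
    moreover have "(h has_vector_derivative (2 * R)) (at u)"
      unfolding h_def by (auto intro!: derivative_eq_intros)
    ultimately have "(L \<circ> h has_vector_derivative (2 * R) *\<^sub>R vector_derivative L (at (h u))) (at u)"
      by (intro vector_diff_chain_at)
    moreover have "L \<circ> h = symm_arc L R" by (auto simp: symm_arc_def h)
    ultimately show ?thesis by (simp add: vector_derivative_at)
  qed
  let ?g = "\<lambda>t. f (L t) * vector_derivative L (at t)"
  have "(f has_contour_integral I) (symm_arc L R) \<longleftrightarrow>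
          ((\<lambda>u. (2 * R) *\<^sub>R ?g (h u)) has_integral I) {0..1}"
    unfolding has_contour_integral
    by (rule has_integral_spike_finite_eq[OF fin])
       (use vd in \<open>auto simp: symm_arc_def h\<close>)
  also have "\<dots> \<longleftrightarrow> ((\<lambda>u. ?g (h u)) has_integral (I /\<^sub>R (2 * R))) {0..1}"
    using assms has_integral_cmul_iff[of "2 * R" "\<lambda>u. ?g (h u)" "I /\<^sub>R (2 * R)" "{0..1}"] by simp
  also have "\<dots> \<longleftrightarrow> (?g has_integral I) {-R..R}"
    using assms has_integral_affinity_iff[of "2 * R" ?g "-R" I "-R" R] unfolding h_def by simp
  finally show ?thesis .
qed

lemma winding_number_symm_arc:
  assumes "upward_contour L" "R > 0" "p \<notin> range L"
  shows   "((\<lambda>s. 1 / (s - p)) has_contour_integral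
             complex_of_real (2 * pi) * \<i> * winding_number (symm_arc L R) p) (symm_arc L R)"
proof (rule has_contour_integral_winding_number)
  show "valid_path (symm_arc L R)" "p \<notin> path_image (symm_arc L R)"
    using assms valid_path_symm_arc path_image_symm_arc by blast+
qed

text \<open>The reparametrisation in \<open>symm_arc\<close> is the one inside
  \<open>index_along\<close>, so the separation hypotheses speak of the truncations used
  here.\<close>

lemma index_along_alt:
  "index_along L p w \<longleftrightarrow> p \<notin> range L \<and> ((\<lambda>R. winding_number (symm_arc L R) p) \<longlongrightarrow> w) at_top"
  unfolding index_along_def symm_arc_def[abs_def] ..

text \<open>Induction on the pole set: once c q / (s - q) is subtracted, (s - q) G(s) tends to 0, so
  by Riemann's theorem the singularity at q is removable, and the extension has the same limits at
  the remaining points. Residues enter as limits of (s - p) F(s), the form in which they are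
  computed for the kernel.\<close>

lemma subtract_simple_poles:
  fixes F :: "complex \<Rightarrow> complex"
  assumes "open S" "finite pts" "F holomorphic_on (S - pts)" "pts \<subseteq> S"
    and "\<And>p. p \<in> pts \<Longrightarrow> ((\<lambda>s. (s - p) * F s) \<longlongrightarrow> c p) (at p)"
  obtains H where "H holomorphic_on S" "\<And>s. s \<in> S - pts \<Longrightarrow> F s = H s + (\<Sum>p\<in>pts. c p / (s - p))"
proof -
  have "\<exists>H. H holomorphic_on S \<and> (\<forall>s\<in>S - pts. F s = H s + (\<Sum>p\<in>pts. c p / (s - p)))"
    using assms(2-)
  proof (induction pts arbitrary: F rule: finite_induct)
    case (insert q pts)
    define G where "G = (\<lambda>s. F s - c q / (s - q))"
    have lim: "((\<lambda>s. (s - q) * G s) \<longlongrightarrow> c q - c q) (at q)"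
    proof (rule Lim_transform_eventually)
      show "((\<lambda>s. (s - q) * F s - c q) \<longlongrightarrow> c q - c q) (at q)"
        using insert.prems by (intro tendsto_intros) auto
      show "\<forall>\<^sub>F s in at q. (s - q) * F s - c q = (s - q) * G s"
        using eventually_neq_at_within[of q q UNIV]
        by eventually_elim (simp add: G_def right_diff_distrib)
    qed
    have op: "open (S - pts)" using assms(1) insert.hyps by (simp add: finite_imp_closed open_Diff)
    have q: "q \<in> interior (S - pts)" using insert op by (simp add: interior_open)
    have "G holomorphic_on (S - pts) - {q}"
      unfolding G_def using insert.prems(1)
      by (intro holomorphic_intros) (auto elim!: holomorphic_on_subset)
    from holomorphic_on_extend_lim[OF this q] lim
    obtain F' where F': "F' holomorphic_on S - pts" "\<And>z. z \<in> S - pts - {q} \<Longrightarrow> F' z = G z" by auto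
    have "((\<lambda>s. (s - p) * F' s) \<longlongrightarrow> c p) (at p)" if p: "p \<in> pts" for p
    proof (rule Lim_transform_eventually)
      have "p \<noteq> q" using p insert.hyps by auto
      \<comment> \<open>The subtracted term is continuous at p, so the factor s - p kills it in the
        limit.\<close>
      have "((\<lambda>s. (s - p) * F s - (s - p) * (c q / (s - q))) \<longlongrightarrow> c p - (p - p) * (c q / (p - q))) (at p)"
        using insert.prems \<open>p \<noteq> q\<close> p by (intro tendsto_intros) auto
      thus "((\<lambda>s. (s - p) * F s - (s - p) * (c q / (s - q))) \<longlongrightarrow> c p) (at p)" by simp
      \<comment> \<open>A punctured neighbourhood of p that avoids q and the other poles: there the
        extension \<open>F'\<close> agrees with \<open>G\<close>.\<close>
      have "open (S - {q} - (pts - {p}))"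
        using assms(1) insert.hyps by (simp add: finite_imp_closed open_Diff)
      hence "\<forall>\<^sub>F s in at p. s \<in> S - {q} - (pts - {p}) - {p}"
        using p insert.prems \<open>p \<noteq> q\<close> by (intro eventually_at_in_open) auto
      thus "\<forall>\<^sub>F s in at p. (s - p) * F s - (s - p) * (c q / (s - q)) = (s - p) * F' s"
      proof eventually_elim
        case (elim s)
        hence "F' s = G s" by (intro F'(2)) auto
        thus ?case by (simp add: G_def right_diff_distrib)
      qed
    qed
    with insert.IH[OF F'(1)] insert.prems obtain H where
      H: "H holomorphic_on S" "\<And>s. s \<in> S - pts \<Longrightarrow> F' s = H s + (\<Sum>p\<in>pts. c p / (s - p))" by auto
    have "F s = H s + (\<Sum>p\<in>insert q pts. c p / (s - p))" if "s \<in> S - insert q pts" for s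
    proof -
      have "F s = F' s + c q / (s - q)" using F'(2)[of s] that by (simp add: G_def)
      thus ?thesis using H(2)[of s] that insert.hyps by simp
    qed
    with H(1) show ?case by blast
  qed auto
  with that show ?thesis by blast
qed

section \<open>Shifting contours across simple poles\<close>

lemma contour_integral_symm_arc_split:
  assumes L: "upward_contour L" "range L \<subseteq> S" "R > 0" and pts: "finite pts" "range L \<inter> pts = {}"
    and prim: "\<And>s. s \<in> S \<Longrightarrow> (\<Phi> has_field_derivative H s) (at s within S)"
    and F: "\<And>s. s \<in> S - pts \<Longrightarrow> F s = H s + (\<Sum>p\<in>pts. c p / (s - p))"
  shows "contour_integral (symm_arc L R) F = \<Phi> (L R) - \<Phi> (L (-R)) +
           (\<Sum>p\<in>pts. c p * (2 * of_real pi * \<i> * winding_number (symm_arc L R) p))"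
proof -
  have img: "path_image (symm_arc L R) \<subseteq> range L"
    using L(3) by (auto simp: path_image_symm_arc)
  have 1: "(H has_contour_integral (\<Phi> (L R) - \<Phi> (L (-R)))) (symm_arc L R)"
    using contour_integral_primitive[OF prim valid_path_symm_arc[OF L(1,3)]] img L(2) by auto
  have 2: "((\<lambda>s. \<Sum>p\<in>pts. c p * (1 / (s - p))) has_contour_integral
            (\<Sum>p\<in>pts. c p * (complex_of_real (2 * pi) * \<i> * winding_number (symm_arc L R) p)))
           (symm_arc L R)"
    using pts L by (intro has_contour_integral_sum has_contour_integral_lmul winding_number_symm_arc) auto
  from has_contour_integral_add[OF 1 2]
  have "(F has_contour_integral (\<Phi> (L R) - \<Phi> (L (-R)) +
      (\<Sum>p\<in>pts. c p * (complex_of_real (2 * pi) * \<i> * winding_number (symm_arc L R) p)))) (symm_arc L R)"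
  proof (rule has_contour_integral_eq)
    fix s assume "s \<in> path_image (symm_arc L R)"
    hence "s \<in> S - pts" using img L(2) pts(2) by blast
    from F[OF this] show "H s + (\<Sum>p\<in>pts. c p * (1 / (s - p))) = F s" by simp
  qed
  thus ?thesis by (simp add: contour_integral_unique)
qed

text \<open>Mean value inequality on the horizontal segment at height f R: its length is constant,
  while the derivative there is O(1/|f R|). A general \<open>f\<close> serves the upper end (f R =
  R) and the lower end (f R = -R) alike.\<close>

lemma primitive_difference_vanishes:
  assumes "convex S" "\<And>s. s \<in> S \<Longrightarrow> (\<Phi> has_field_derivative H s) (at s within S)"
    and decay: "\<And>s. \<lbrakk>s \<in> S; Re s \<in> closed_segment a b; 1 \<le> \<bar>Im s\<bar>\<rbrakk> \<Longrightarrow> norm (H s) \<le> D / \<bar>Im s\<bar>"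
    and S: "eventually (\<lambda>R. Complex a (f R) \<in> S) F" "eventually (\<lambda>R. Complex b (f R) \<in> S) F"
    and f: "filterlim f at_infinity F"
  shows "((\<lambda>R. \<Phi> (Complex a (f R)) - \<Phi> (Complex b (f R))) \<longlongrightarrow> 0) F"
proof (rule Lim_null_comparison)
  have "eventually (\<lambda>R. 1 \<le> norm (f R)) F"
    using f unfolding filterlim_at_infinity[OF order_refl] by (metis zero_less_one)
  with S show "\<forall>\<^sub>F R in F. norm (\<Phi> (Complex a (f R)) - \<Phi> (Complex b (f R))) \<le> D * \<bar>a - b\<bar> * inverse \<bar>f R\<bar>"
  proof eventually_elim
    case (elim R)
    let ?A = "Complex a (f R)" and ?B = "Complex b (f R)"
    have sub: "closed_segment ?A ?B \<subseteq> S"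
      using elim assms(1) by (simp add: closed_segment_subset)
    have "norm (\<Phi> ?A - \<Phi> ?B) \<le> D / \<bar>f R\<bar> * norm (?A - ?B)"
    proof (rule field_differentiable_bound[of "closed_segment ?A ?B"])
      fix z assume z: "z \<in> closed_segment ?A ?B"
      show "(\<Phi> has_field_derivative H z) (at z within closed_segment ?A ?B)"
        using z sub assms(2) by (meson DERIV_subset subsetD)
      from z obtain u where u: "0 \<le> u" "u \<le> 1" "z = (1 - u) *\<^sub>R ?A + u *\<^sub>R ?B"
        by (auto simp: in_segment)
      hence "Re z = (1 - u) * a + u * b" "Im z = f R"
        by (simp_all add: u(3) algebra_simps)
      moreover from this(1) u have "Re z \<in> closed_segment a b" by (auto simp: in_segment)
      ultimately show "norm (H z) \<le> D / \<bar>f R\<bar>"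
        using decay[of z] z sub elim by auto
    qed auto
    also have "?A - ?B = of_real (a - b)" by (simp add: complex_eq_iff)
    also have "norm (of_real (a - b) :: complex) = \<bar>a - b\<bar>" by (rule norm_of_real)
    finally show ?case by (simp add: field_simps)
  qed
  have "((\<lambda>R. inverse \<bar>f R\<bar>) \<longlongrightarrow> 0) F"
    using filterlim_at_infinity_imp_norm_at_top[OF f] unfolding real_norm_def
    by (rule tendsto_inverse_0_at_top)
  hence "((\<lambda>R. D * \<bar>a - b\<bar> * inverse \<bar>f R\<bar>) \<longlongrightarrow> D * \<bar>a - b\<bar> * 0) F"
    by (intro tendsto_intros)
  thus "((\<lambda>R. D * \<bar>a - b\<bar> * inverse \<bar>f R\<bar>) \<longlongrightarrow> 0) F" by simp
qed

text \<open>Poles on the real axis satisfy |s - p| \<ge> |Im s|, so the polar parts decay like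
  \<open>F\<close> itself, at the rate 1/|Im s| that makes the ends of the two contours cancel.
  Decay is asked for on every strip because the abscissas of the straight ends become known only
  inside the proof. Convergence is claimed for the difference only, as this rate does not force
  either arc integral to converge.\<close>

lemma contour_shift:
  fixes F :: "complex \<Rightarrow> complex"
  assumes S: "open S" "convex S"
    and pts: "finite pts" "pts \<subseteq> S" "pts \<subseteq> \<real>"
    and F: "F holomorphic_on S - pts"
    and res: "\<And>p. p \<in> pts \<Longrightarrow> ((\<lambda>s. (s - p) * F s) \<longlongrightarrow> c p) (at p)"
    and L: "upward_contour L" "range L \<subseteq> S" "\<And>p. p \<in> pts \<Longrightarrow> index_along L p (w p)"
    and L': "upward_contour L'" "range L' \<subseteq> S" "\<And>p. p \<in> pts \<Longrightarrow> index_along L' p (w' p)"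
    and decay: "\<And>a b. \<exists>C. \<forall>s. Re s \<in> closed_segment a b \<longrightarrow> 1 \<le> \<bar>Im s\<bar> \<longrightarrow> norm (F s) \<le> C / \<bar>Im s\<bar>"
  shows "((\<lambda>R. contour_integral (symm_arc L R) F - contour_integral (symm_arc L' R) F) \<longlongrightarrow>
           2 * of_real pi * \<i> * (\<Sum>p\<in>pts. c p * (w p - w' p))) at_top"
proof -
  \<comment> \<open>Without its polar parts \<open>F\<close> has a primitive on \<open>S\<close>; the polar parts contribute winding numbers.\<close>
  obtain H where H: "H holomorphic_on S" "\<And>s. s \<in> S - pts \<Longrightarrow> F s = H s + (\<Sum>p\<in>pts. c p / (s - p))"
    using subtract_simple_poles[OF S(1) pts(1) F pts(2) res] by blast
  obtain \<Phi> where \<Phi>: "\<And>s. s \<in> S \<Longrightarrow> (\<Phi> has_field_derivative H s) (at s within S)"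
    using holomorphic_convex_primitive'[OF S(2,1) H(1)] by blast
  obtain a T where a: "T > 0" "\<And>t. \<bar>t\<bar> \<ge> T \<Longrightarrow> L t = Complex a t"
    using upward_contourD[OF L(1)] by blast
  obtain b T' where b: "T' > 0" "\<And>t. \<bar>t\<bar> \<ge> T' \<Longrightarrow> L' t = Complex b t"
    using upward_contourD[OF L'(1)] by blast
  obtain C where C: "\<And>s. \<lbrakk>Re s \<in> closed_segment a b; 1 \<le> \<bar>Im s\<bar>\<rbrakk> \<Longrightarrow> norm (F s) \<le> C / \<bar>Im s\<bar>"
    using decay[of a b] by blast
  \<comment> \<open>Each polar part adds at most |c p| / |Im s| to the bound for
    \<open>F\<close>.\<close>
  define D where "D = C + (\<Sum>p\<in>pts. norm (c p))"
  have HD: "norm (H s) \<le> D / \<bar>Im s\<bar>" if s: "s \<in> S" "Re s \<in> closed_segment a b" "1 \<le> \<bar>Im s\<bar>" for s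
  proof -
    have "Im p = 0" if "p \<in> pts" for p using pts(3) that by (meson complex_is_Real_iff subsetD)
    hence *: "\<bar>Im s\<bar> \<le> norm (s - p)" if "p \<in> pts" for p
      using abs_Im_le_cmod[of "s - p"] that by simp
    have "s \<notin> pts" using * s(3) by force
    hence "H s = F s - (\<Sum>p\<in>pts. c p / (s - p))" using H(2)[of s] s(1) by simp
    also have "norm \<dots> \<le> norm (F s) + (\<Sum>p\<in>pts. norm (c p / (s - p)))"
      by (rule order_trans[OF norm_triangle_ineq4 add_left_mono[OF norm_sum]])
    also have "\<dots> \<le> C / \<bar>Im s\<bar> + (\<Sum>p\<in>pts. norm (c p) / \<bar>Im s\<bar>)"
    proof (intro add_mono sum_mono)
      fix p assume p: "p \<in> pts"
      show "norm (c p / (s - p)) \<le> norm (c p) / \<bar>Im s\<bar>"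
        unfolding norm_divide using *[OF p] s(3) by (intro divide_left_mono mult_pos_pos) auto
    qed (use C s in auto)
    also have "\<dots> = D / \<bar>Im s\<bar>" by (simp add: D_def add_divide_distrib sum_divide_distrib)
    finally show ?thesis .
  qed
  have ev: "\<forall>\<^sub>F R in at_top. L R = Complex a R" "\<forall>\<^sub>F R in at_top. L' R = Complex b R"
     "\<forall>\<^sub>F R in at_top. L (-R) = Complex a (-R)" "\<forall>\<^sub>F R in at_top. L' (-R) = Complex b (-R)"
    by (rule eventually_mono[OF eventually_ge_at_top[of T]], use a in simp)
       (rule eventually_mono[OF eventually_ge_at_top[of T']], use b in simp,
        rule eventually_mono[OF eventually_ge_at_top[of T]], use a in simp,
        rule eventually_mono[OF eventually_ge_at_top[of T']], use b in simp)
  have evS: "\<forall>\<^sub>F R in at_top. Complex a R \<in> S" "\<forall>\<^sub>F R in at_top. Complex b R \<in> S"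
     "\<forall>\<^sub>F R in at_top. Complex a (-R) \<in> S" "\<forall>\<^sub>F R in at_top. Complex b (-R) \<in> S"
    by (rule eventually_mono[OF ev(1)], use L(2) in \<open>metis rangeI subsetD\<close>)
       (rule eventually_mono[OF ev(2)], use L'(2) in \<open>metis rangeI subsetD\<close>,
        rule eventually_mono[OF ev(3)], use L(2) in \<open>metis rangeI subsetD\<close>,
        rule eventually_mono[OF ev(4)], use L'(2) in \<open>metis rangeI subsetD\<close>)
  have "filterlim (\<lambda>R::real. R) at_infinity at_top"
    by (intro filterlim_at_top_imp_at_infinity filterlim_ident)
  note lim1 = primitive_difference_vanishes[OF S(2) \<Phi> HD evS(1,2) this]
  have "\<forall>\<^sub>F R in at_top. \<Phi> (Complex a R) - \<Phi> (Complex b R) = \<Phi> (L R) - \<Phi> (L' R)"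
    using ev(1,2) by eventually_elim simp
  with lim1 have lim1: "((\<lambda>R. \<Phi> (L R) - \<Phi> (L' R)) \<longlongrightarrow> 0) at_top"
    by (rule Lim_transform_eventually)
  have "filterlim (\<lambda>R::real. - R) at_infinity at_top"
    by (rule filterlim_mono[OF filterlim_uminus_at_bot_at_top at_bot_le_at_infinity order_refl])
  note lim2 = primitive_difference_vanishes[OF S(2) \<Phi> HD evS(3,4) this]
  have "\<forall>\<^sub>F R in at_top. \<Phi> (Complex a (-R)) - \<Phi> (Complex b (-R)) = \<Phi> (L (-R)) - \<Phi> (L' (-R))"
    using ev(3,4) by eventually_elim simp
  with lim2 have lim2: "((\<lambda>R. \<Phi> (L (-R)) - \<Phi> (L' (-R))) \<longlongrightarrow> 0) at_top"
    by (rule Lim_transform_eventually)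
  have "((\<lambda>R. (\<Phi> (L R) - \<Phi> (L' R)) - (\<Phi> (L (-R)) - \<Phi> (L' (-R))) +
      (\<Sum>p\<in>pts. c p * (2 * of_real pi * \<i> * (winding_number (symm_arc L R) p -
         winding_number (symm_arc L' R) p)))) \<longlongrightarrow>
      0 - 0 + (\<Sum>p\<in>pts. c p * (2 * of_real pi * \<i> * (w p - w' p)))) at_top"
    using L(3) L'(3) by (intro tendsto_intros lim1 lim2) (auto simp: index_along_alt)
  moreover have "\<forall>\<^sub>F R in at_top. (\<Phi> (L R) - \<Phi> (L' R)) - (\<Phi> (L (-R)) - \<Phi> (L' (-R))) +
      (\<Sum>p\<in>pts. c p * (2 * of_real pi * \<i> * (winding_number (symm_arc L R) p -
         winding_number (symm_arc L' R) p))) =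
      contour_integral (symm_arc L R) F - contour_integral (symm_arc L' R) F"
    using eventually_gt_at_top[of 0]
  proof eventually_elim
    case (elim R)
    have d: "range L \<inter> pts = {}" "range L' \<inter> pts = {}"
      using L(3) L'(3) by (auto simp: index_along_def)
    show ?case
      by (subst contour_integral_symm_arc_split[OF L(1,2) elim pts(1) d(1) \<Phi> H(2)], assumption, assumption,
          subst contour_integral_symm_arc_split[OF L'(1,2) elim pts(1) d(2) \<Phi> H(2)], assumption, assumption)
         (simp add: sum_subtractf right_diff_distrib)
  qed
  ultimately have "((\<lambda>R. contour_integral (symm_arc L R) F - contour_integral (symm_arc L' R) F) \<longlongrightarrow>
      0 - 0 + (\<Sum>p\<in>pts. c p * (2 * of_real pi * \<i> * (w p - w' p)))) at_top"
    by (rule Lim_transform_eventually)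
  also have "0 - 0 + (\<Sum>p\<in>pts. c p * (2 * of_real pi * \<i> * (w p - w' p))) =
             2 * of_real pi * \<i> * (\<Sum>p\<in>pts. c p * (w p - w' p))"
    by (simp add: sum_distrib_left mult_ac)
  finally show ?thesis .
qed

section \<open>Vertical lines and bounds for the Gamma function\<close>

lemma upward_contour_Complex: "upward_contour (Complex \<sigma>)"
proof -
  have "(\<lambda>t. Complex \<sigma> t) C1_differentiable_on A" for A
  proof -
    have "((\<lambda>t. Complex \<sigma> t) has_vector_derivative \<i>) (at x)" for x
      unfolding Complex_eq by (auto intro!: derivative_eq_intros)
    thus ?thesis unfolding C1_differentiable_on_def by (intro exI[of _ "\<lambda>_. \<i>"]) auto
  qed
  thus ?thesis
    unfolding upward_contour_def by (auto simp: inj_def C1_differentiable_imp_piecewise)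
qed

lemma vector_derivative_Complex [simp]: "vector_derivative (Complex \<sigma>) (at t) = \<i>"
proof -
  have "((\<lambda>t. Complex \<sigma> t) has_vector_derivative \<i>) (at t)"
    unfolding Complex_eq by (auto intro!: derivative_eq_intros)
  thus ?thesis by (simp add: vector_derivative_at)
qed

text \<open>For large R, Ln (w \<plusminus> iR) = ln R + Ln (w/R \<plusminus> i); the real
  logarithms cancel and the rest tends to Ln i - Ln (-i) = i pi, the principal branch being
  continuous at both points.\<close>

lemma tendsto_Ln_diff_vertical:
  "((\<lambda>R. Ln (w + \<i> * of_real R) - Ln (w - \<i> * of_real R)) \<longlongrightarrow> \<i> * of_real pi) at_top"
proof -
  have lim0: "((\<lambda>R::real. w / of_real R) \<longlongrightarrow> 0) at_top"
    by (rule tendsto_divide_0[OF tendsto_const filterlim_of_real_at_infinity])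
  have lim: "((\<lambda>R::real. w / of_real R + v) \<longlongrightarrow> v) at_top" for v
    using tendsto_add[OF lim0 tendsto_const[of v]] by simp
  have ev: "\<forall>\<^sub>F R in at_top. Ln (w + v * of_real R) = of_real (ln R) + Ln (w / of_real R + v)"
    if "v \<noteq> 0" for v
    using eventually_gt_at_top[of 0] tendsto_imp_eventually_ne[OF lim that]
  proof eventually_elim
    case (elim R)
    have "Ln (w + v * of_real R) = Ln (of_real R * (w / of_real R + v))"
      using elim by (simp add: ring_distribs mult.commute)
    thus ?case using elim by (simp add: Ln_times_of_real Ln_of_real)
  qed
  have "((\<lambda>R. Ln (w / of_real R + \<i>) - Ln (w / of_real R + (-\<i>))) \<longlongrightarrow> Ln \<i> - Ln (-\<i>)) at_top"
    by (intro tendsto_diff tendsto_Ln lim) (auto simp: complex_nonpos_Reals_iff)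
  moreover have "\<forall>\<^sub>F R in at_top. Ln (w / of_real R + \<i>) - Ln (w / of_real R + (-\<i>)) =
                   Ln (w + \<i> * of_real R) - Ln (w - \<i> * of_real R)"
    using ev[of \<i>, OF complex_i_not_zero] ev[of "-\<i>"] by (auto elim: eventually_elim2)
  ultimately have "((\<lambda>R. Ln (w + \<i> * of_real R) - Ln (w - \<i> * of_real R)) \<longlongrightarrow> Ln \<i> - Ln (-\<i>)) at_top"
    by (rule Lim_transform_eventually)
  thus ?thesis by simp
qed

text \<open>On the half-plane to the right of p, Ln (s - p) is a primitive of 1/(s - p), so the
  winding number is a difference of logarithms over 2 pi i and tends to a half turn.\<close>

lemma index_along_Complex_left:
  assumes "Re p < \<sigma>" shows "index_along (Complex \<sigma>) p (1/2)"
proof -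
  have p: "p \<notin> range (Complex \<sigma>)" using assms by auto
  define w where "w = of_real \<sigma> - p"
  have "((\<lambda>R. (Ln (w + \<i> * of_real R) - Ln (w - \<i> * of_real R)) / (2 * of_real pi * \<i>)) \<longlongrightarrow>
          \<i> * of_real pi / (2 * of_real pi * \<i>)) at_top"
    by (intro tendsto_intros tendsto_Ln_diff_vertical) auto
  moreover have "\<forall>\<^sub>F R in at_top. (Ln (w + \<i> * of_real R) - Ln (w - \<i> * of_real R)) / (2 * of_real pi * \<i>) =
      winding_number (symm_arc (Complex \<sigma>) R) p"
    using eventually_gt_at_top[of 0]
  proof eventually_elim
    case (elim R)
    have "((\<lambda>s. 1 / (s - p)) has_contour_integral
            Ln (pathfinish (symm_arc (Complex \<sigma>) R) - p) - Ln (pathstart (symm_arc (Complex \<sigma>) R) - p))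
           (symm_arc (Complex \<sigma>) R)"
    proof (rule contour_integral_primitive)
      fix s assume "s \<in> {s. Re s > Re p}"
      thus "((\<lambda>s. Ln (s - p)) has_field_derivative 1 / (s - p)) (at s within {s. Re s > Re p})"
        by (auto intro!: derivative_eq_intros simp: complex_nonpos_Reals_iff inverse_eq_divide)
    qed (use assms elim in \<open>auto simp: path_image_symm_arc intro!: valid_path_symm_arc upward_contour_Complex\<close>)
    from contour_integral_unique[OF this]
      contour_integral_unique[OF winding_number_symm_arc[OF upward_contour_Complex elim p]]
    show ?case by (simp add: w_def Complex_eq field_simps)
  qed
  ultimately have "((\<lambda>R. winding_number (symm_arc (Complex \<sigma>) R) p) \<longlongrightarrow>
                     \<i> * of_real pi / (2 * of_real pi * \<i>)) at_top"
    by (rule Lim_transform_eventually)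
  thus ?thesis using p by (simp add: index_along_alt)
qed

text \<open>Now s - p lies in the left half-plane, where the principal branch has its cut. Ln (p -
  s) is the primitive used instead; it swaps the roles of w + iR and w - iR, whence the
  sign.\<close>

lemma index_along_Complex_right:
  assumes "Re p > \<sigma>" shows "index_along (Complex \<sigma>) p (-1/2)"
proof -
  have p: "p \<notin> range (Complex \<sigma>)" using assms by auto
  define w where "w = p - of_real \<sigma>"
  have "((\<lambda>R. - (Ln (w + \<i> * of_real R) - Ln (w - \<i> * of_real R)) / (2 * of_real pi * \<i>)) \<longlongrightarrow>
          - (\<i> * of_real pi) / (2 * of_real pi * \<i>)) at_top"
    by (intro tendsto_intros tendsto_Ln_diff_vertical) auto
  moreover have "\<forall>\<^sub>F R in at_top. - (Ln (w + \<i> * of_real R) - Ln (w - \<i> * of_real R)) / (2 * of_real pi * \<i>) =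
      winding_number (symm_arc (Complex \<sigma>) R) p"
    using eventually_gt_at_top[of 0]
  proof eventually_elim
    case (elim R)
    have "((\<lambda>s. 1 / (s - p)) has_contour_integral
            Ln (p - pathfinish (symm_arc (Complex \<sigma>) R)) - Ln (p - pathstart (symm_arc (Complex \<sigma>) R)))
           (symm_arc (Complex \<sigma>) R)"
    proof (rule contour_integral_primitive)
      fix s assume s: "s \<in> {s. Re s < Re p}"
      hence "s \<noteq> p" by auto
      with s show "((\<lambda>s. Ln (p - s)) has_field_derivative 1 / (s - p)) (at s within {s. Re s < Re p})"
        by (auto intro!: derivative_eq_intros simp: complex_nonpos_Reals_iff field_simps)
    qed (use assms elim in \<open>auto simp: path_image_symm_arc intro!: valid_path_symm_arc upward_contour_Complex\<close>)
    from contour_integral_unique[OF this]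
      contour_integral_unique[OF winding_number_symm_arc[OF upward_contour_Complex elim p]]
    show ?case by (simp add: w_def Complex_eq field_simps)
  qed
  ultimately have "((\<lambda>R. winding_number (symm_arc (Complex \<sigma>) R) p) \<longlongrightarrow>
                     - (\<i> * of_real pi) / (2 * of_real pi * \<i>)) at_top"
    by (rule Lim_transform_eventually)
  thus ?thesis using p by (simp add: index_along_alt)
qed

section \<open>Size of \<Gamma> on vertical strips and on lines far to the left\<close>

lemma norm_Gamma_le:
  fixes z :: complex
  assumes "Re z > 0" shows "norm (Gamma z) \<le> Gamma (Re z)"
proof -
  have "norm (integral {0..} (\<lambda>t. of_real t powr (z - 1) / complex_of_real (exp t))) \<le>
        integral {0..} (\<lambda>t. t powr (Re z - 1) / exp t)"
  proof (rule integral_norm_bound_integral)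
    fix t :: real assume "t \<in> {0..}"
    thus "norm (of_real t powr (z - 1) / complex_of_real (exp t)) \<le> t powr (Re z - 1) / exp t"
      by (simp add: norm_divide norm_powr_real_powr del: of_real_exp)
  qed (use Gamma_integral_complex[OF assms] Gamma_integral_real[OF assms] in blast)+
  thus ?thesis
    using Gamma_integral_complex[OF assms] Gamma_integral_real[OF assms] by (simp add: integral_unique)
qed

text \<open>The recurrence pushes s by n to the right into Re \<ge> 1, where \<Gamma> is bounded on
  the strip; going back divides by n factors s + j, each of modulus at least |Im s| \<ge> 1.\<close>

lemma Gamma_strip_bound:
  obtains C where "\<And>s::complex. \<lbrakk>Re s \<in> closed_segment a b; 1 \<le> \<bar>Im s\<bar>\<rbrakk> \<Longrightarrow> norm (Gamma s) \<le> C / \<bar>Im s\<bar>"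
proof -
  \<comment> \<open>The final + 1 guarantees at least one factor in the Pochhammer product, which
    supplies the decay.\<close>
  define n where "n = nat \<lceil>max 0 (1 - min a b)\<rceil> + 1"
  have n: "min a b + real n \<ge> 1" "n \<ge> 1" unfolding n_def by linarith+
  have "continuous_on {1..max a b + real n} (Gamma :: real \<Rightarrow> real)"
    by (intro continuous_intros) (auto elim!: nonpos_Ints_cases)
  hence "bounded ((Gamma :: real \<Rightarrow> real) ` {1..max a b + real n})"
    by (intro compact_imp_bounded compact_continuous_image) auto
  then obtain C where "\<forall>x\<in>{1..max a b + real n}. \<bar>Gamma x :: real\<bar> \<le> C"
    by (auto simp: bounded_iff)
  hence C: "\<And>x. x \<in> {1..max a b + real n} \<Longrightarrow> Gamma x \<le> C" by fastforce
  show ?thesis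
  proof (rule that[of C])
    fix s :: complex assume s: "Re s \<in> closed_segment a b" "1 \<le> \<bar>Im s\<bar>"
    have Re: "min a b \<le> Re s" "Re s \<le> max a b"
      using s(1) by (auto simp: closed_segment_eq_real_ivl split: if_splits)
    have ni: "s \<notin> \<int>\<^sub>\<le>\<^sub>0" using s(2) by (auto elim!: nonpos_Ints_cases)
    have "\<bar>Im s\<bar> \<le> \<bar>Im s\<bar> ^ n" using s(2) n(2) by (metis power_increasing power_one_right)
    also have "\<dots> = (\<Prod>i=0..<n. \<bar>Im s\<bar>)" by simp
    also have "\<dots> \<le> (\<Prod>i=0..<n. norm (s + of_nat i))"
    proof (rule prod_mono)
      fix i show "0 \<le> \<bar>Im s\<bar> \<and> \<bar>Im s\<bar> \<le> norm (s + of_nat i)"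
        using abs_Im_le_cmod[of "s + of_nat i"] by simp
    qed
    also have "\<dots> = norm (pochhammer s n)" by (simp add: pochhammer_prod prod_norm)
    finally have poch: "\<bar>Im s\<bar> \<le> norm (pochhammer s n)" .
    have "norm (Gamma (s + of_nat n)) \<le> Gamma (Re s + real n)"
      using norm_Gamma_le[of "s + of_nat n"] Re n by simp
    also have "\<dots> \<le> C" using C[of "Re s + real n"] Re n by auto
    finally have *: "norm (Gamma (s + of_nat n)) \<le> C" .
    have "pochhammer s n \<noteq> 0" using poch s(2) by auto
    moreover have "Gamma s \<noteq> 0" using ni by (simp add: Gamma_eq_zero_iff)
    ultimately have "Gamma s = Gamma (s + of_nat n) / pochhammer s n"
      using pochhammer_Gamma[OF ni, of n] by (metis mult.commute nonzero_divide_eq_eq)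
    hence "norm (Gamma s) = norm (Gamma (s + of_nat n)) / norm (pochhammer s n)"
      by (simp add: norm_divide)
    also have "\<dots> \<le> C / \<bar>Im s\<bar>" using * poch s(2) order_trans[OF norm_ge_zero *] by (intro frac_le) auto
    finally show "norm (Gamma s) \<le> C / \<bar>Im s\<bar>" .
  qed
qed

lemma half_odd_notin_nonpos_Ints: "Complex (- (real K + 1/2)) t \<notin> \<int>\<^sub>\<le>\<^sub>0"
proof
  assume "Complex (- (real K + 1/2)) t \<in> \<int>\<^sub>\<le>\<^sub>0"
  then obtain m where "Complex (- (real K + 1/2)) t = of_int m" by (auto elim: nonpos_Ints_cases)
  hence "2 * real_of_int m = of_int (- (2 * int K + 1))" by (auto simp: complex_eq_iff)
  hence "2 * m = - (2 * int K + 1)" by linarith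
  thus False by presburger
qed

text \<open>Each step to the left divides by s, and |s| \<ge> |Re s| > K + 1 builds up the factorial
  that lets the line integrals vanish as K grows. The base case combines |\<Gamma>(1/2 + it)| \<le>
  \<Gamma>(1/2) = sqrt pi with |-1/2 + it| = |1/2 + it|; this modulus is kept as decay in t.\<close>

lemma Gamma_left_line_bound:
  "norm (Gamma (Complex (- (real K + 1/2)) t)) \<le> sqrt pi / (fact K * norm (Complex (1/2) t))"
proof (induction K)
  case 0
  define s where "s = Complex (-1/2) t"
  have ni: "s \<notin> \<int>\<^sub>\<le>\<^sub>0" using half_odd_notin_nonpos_Ints[of 0 t] by (simp add: s_def)
  have "s + 1 = Complex (1/2) t" by (simp add: s_def complex_eq_iff)
  with Gamma_plus1[OF ni] have "norm (Gamma s) * norm s = norm (Gamma (Complex (1/2) t))"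
    by (metis norm_mult mult.commute)
  also have "\<dots> \<le> sqrt pi" using norm_Gamma_le[of "Complex (1/2) t"] by (simp add: Gamma_one_half_real)
  also have "norm s = norm (Complex (1/2) t)" by (simp add: s_def cmod_def)
  moreover have "norm (Complex (1/2) t) > 0" by (simp add: complex_eq_iff)
  ultimately show ?case by (simp add: s_def field_simps)
next
  case (Suc K)
  define s where "s = Complex (- (real (Suc K) + 1/2)) t"
  have Re: "real K + 1 \<le> norm s" using abs_Re_le_cmod[of s] by (simp add: s_def)
  have ni: "s \<notin> \<int>\<^sub>\<le>\<^sub>0" unfolding s_def by (rule half_odd_notin_nonpos_Ints)
  have "s + 1 = Complex (- (real K + 1/2)) t" by (simp add: s_def complex_eq_iff)
  with Gamma_plus1[OF ni] have "norm (Gamma s) * norm s = norm (Gamma (Complex (- (real K + 1/2)) t))"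
    by (metis norm_mult mult.commute)
  hence "norm (Gamma s) = norm (Gamma (Complex (- (real K + 1/2)) t)) / norm s"
    using Re by (subst eq_divide_eq) auto
  also have "\<dots> \<le> (sqrt pi / (fact K * norm (Complex (1/2) t))) / (real K + 1)"
    using Suc Re by (intro frac_le) auto
  also have "\<dots> = sqrt pi / (fact (Suc K) * norm (Complex (1/2) t))" by (simp add: field_simps)
  finally show ?case by (simp add: s_def)
qed

section \<open>The Mellin--Barnes kernel\<close>

lemma integral_UNIV_symmetric_limit:
  fixes f :: "real \<Rightarrow> 'a :: banach"
  assumes "f integrable_on UNIV"
  shows "((\<lambda>R. integral {-R..R} f) \<longlongrightarrow> integral UNIV f) at_top"
proof (rule tendstoI)
  fix e :: real assume "e > 0"
  moreover have "(f has_integral integral UNIV f) UNIV"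
    using assms by (rule integrable_integral)
  ultimately obtain B where B: "B > 0"
    "\<And>a b. ball 0 B \<subseteq> cbox a b \<Longrightarrow> norm (integral (cbox a b) f - integral UNIV f) < e"
    by (subst (asm) has_integral_alt') force
  show "\<forall>\<^sub>F R in at_top. dist (integral {-R..R} f) (integral UNIV f) < e"
    using eventually_ge_at_top[of B]
  proof eventually_elim
    case (elim R)
    hence "ball 0 B \<subseteq> cbox (-R) R" by (auto simp: dist_norm)
    from B(2)[OF this] show ?case by (simp add: dist_norm)
  qed
qed

text \<open>On [-T, T] only integrability is known, not a bound, so only the tail is compared with a
  multiple of 1/(1 + t^2); the cut-off middle is added back at the end.\<close>

lemma integrable_on_UNIV_if_square_decay:
  fixes f :: "real \<Rightarrow> 'a :: euclidean_space"
  assumes int: "\<And>R. R > 0 \<Longrightarrow> f integrable_on {-R..R}"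
    and T: "T \<ge> 1" "\<And>t. \<bar>t\<bar> \<ge> T \<Longrightarrow> norm (f t) \<le> C / t\<^sup>2"
  shows "f integrable_on UNIV"
proof -
  let ?g = "\<lambda>t. if t \<in> {-T..T} then f t else 0"
  have g: "?g integrable_on UNIV"
    using int[of T] T(1) by (subst integrable_restrict_UNIV) auto
  have "(\<lambda>t. f t - ?g t) integrable_on UNIV"
  proof (rule integrable_on_all_intervals_integrable_bound)
    fix a b :: real
    have "f integrable_on {- (\<bar>a\<bar> + \<bar>b\<bar> + 1)..\<bar>a\<bar> + \<bar>b\<bar> + 1}" by (rule int) auto
    hence "f integrable_on cbox a b" unfolding cbox_interval by (rule integrable_on_subinterval) auto
    moreover have "?g integrable_on cbox a b"
      using g by (rule integrable_on_subcbox) auto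
    ultimately show "(\<lambda>t. if t \<in> UNIV then f t - ?g t else 0) integrable_on cbox a b"
      by (simp add: integrable_diff)
  next
    have "(\<lambda>x. inverse (1 + x\<^sup>2)) integrable_on (UNIV :: real set)"
      using set_borel_integral_eq_integral(1)[OF integrable_inverse_1_plus_square] by simp
    thus "(\<lambda>x. (2 * \<bar>C\<bar>) * inverse (1 + x\<^sup>2)) integrable_on (UNIV :: real set)"
      by (rule integrable_on_mult_right)
  next
    fix t :: real
    show "norm (f t - ?g t) \<le> 2 * \<bar>C\<bar> * inverse (1 + t\<^sup>2)"
    proof (cases "t \<in> {-T..T}")
      case False
      hence t: "\<bar>t\<bar> \<ge> T" by auto
      with T(1) have "1 \<le> t\<^sup>2" using abs_le_square_iff[of 1 t] by simp
      have pos: "1 + t\<^sup>2 > 0" by (simp add: add_pos_nonneg)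
      \<comment> \<open>For |t| \<ge> 1 one has 1 + t^2 \<le> 2 t^2, the origin of the constant 2 in
        the majorant.\<close>
      have "inverse (2 * t\<^sup>2) \<le> inverse (1 + t\<^sup>2)"
        using \<open>1 \<le> t\<^sup>2\<close> pos by (intro le_imp_inverse_le) auto
      hence "2 * inverse (2 * t\<^sup>2) \<le> 2 * inverse (1 + t\<^sup>2)" by (rule mult_left_mono) simp
      also have "2 * inverse (2 * t\<^sup>2) = 1 / t\<^sup>2" by (simp only: inverse_eq_divide) 
      finally have *: "1 / t\<^sup>2 \<le> 2 * inverse (1 + t\<^sup>2)" .
      have "C / t\<^sup>2 \<le> \<bar>C\<bar> * (1 / t\<^sup>2)" by (simp add: divide_right_mono)
      also have "\<dots> \<le> \<bar>C\<bar> * (2 * inverse (1 + t\<^sup>2))" using * by (rule mult_left_mono) simp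
      also have "\<dots> = 2 * \<bar>C\<bar> * inverse (1 + t\<^sup>2)" by simp
      finally have "C / t\<^sup>2 \<le> 2 * \<bar>C\<bar> * inverse (1 + t\<^sup>2)" .
      thus ?thesis using T(2)[OF t] False by auto
    qed auto
  qed
  from integrable_add[OF this g] show ?thesis by simp
qed

text \<open>With u = \<rho> s the kernel times ds becomes \<Gamma>(u) x^(-u) / (l - u) du, and
  \<Gamma>(u) / (l - u) is the Mellin transform, for 0 < Re u < l, of x^(-l) times the lower
  incomplete Gamma function. The scale \<rho>, later r, stays explicit because the contour is given
  in the variable s.\<close>

definition mellin_kernel :: "real \<Rightarrow> real \<Rightarrow> real \<Rightarrow> complex \<Rightarrow> complex" where
  "mellin_kernel \<rho> l x s =
     Gamma (of_real \<rho> * s) * of_real x powr (- (of_real \<rho> * s)) / (of_real (l / \<rho>) - s)"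

section \<open>Poles and residues of the kernel\<close>

lemma of_real_mult_eq_minus_of_natD:
  fixes s :: complex
  assumes "of_real \<rho> * s = - of_nat n" "\<rho> \<noteq> 0"
  shows "s = of_real (- (real n / \<rho>))"
proof -
  have "s = of_real \<rho> * s / of_real \<rho>" using assms(2) by simp
  thus ?thesis unfolding assms(1) by simp
qed

text \<open>The residue (-1)^n / n! of \<Gamma> at -n picks up 1/\<rho> from u = \<rho> s, and the
  denominator contributes \<rho>/(l + n): the scale cancels, leaving the n-th term of the incomplete
  Gamma series.\<close>

lemma mellin_kernel_residue:
  assumes "\<rho> > 0" "l > 0" "x > 0"
  shows "((\<lambda>s. (s - of_real (- (real n / \<rho>))) * mellin_kernel \<rho> l x s) \<longlongrightarrow>
           of_real ((-1) ^ n * x ^ n / (fact n * (l + real n)))) (at (of_real (- (real n / \<rho>))))"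
proof -
  let ?p = "complex_of_real (- (real n / \<rho>))"
  have lim: "((\<lambda>s. complex_of_real \<rho> * s) \<longlongrightarrow> - of_nat n) (at ?p)"
    using assms by (auto intro!: tendsto_eq_intros)
  have ev: "\<forall>\<^sub>F s in at ?p. of_real \<rho> * s \<noteq> - of_nat n"
    using eventually_neq_at_within[of ?p ?p UNIV]
  proof eventually_elim
    case (elim s)
    show ?case
    proof
      assume "of_real \<rho> * s = - of_nat n"
      hence "s = ?p" using assms(1) by (intro of_real_mult_eq_minus_of_natD) auto
      thus False using elim by simp
    qed
  qed
  have lim1: "((\<lambda>s. Gamma (of_real \<rho> * s) * (of_real \<rho> * s + of_nat n)) \<longlongrightarrow> (-1) ^ n / fact n) (at ?p)"
    using Gamma_residues lim ev by (rule tendsto_compose_eventually)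
  have "of_real (l / \<rho>) - ?p = of_real ((l + real n) / \<rho>)" by (simp add: add_divide_distrib)
  moreover have "(l + real n) / \<rho> \<noteq> 0" using assms by (simp add: add_pos_nonneg)
  ultimately have nz: "of_real (l / \<rho>) - ?p \<noteq> 0" by (simp only: of_real_eq_0_iff not_False_eq_True)
  have "((\<lambda>s. 1 / of_real \<rho> * (Gamma (of_real \<rho> * s) * (of_real \<rho> * s + of_nat n)) *
              of_real x powr (- (of_real \<rho> * s)) / (of_real (l / \<rho>) - s)) \<longlongrightarrow>
          1 / of_real \<rho> * ((-1) ^ n / fact n) * of_real x powr (- (of_real \<rho> * ?p)) / (of_real (l / \<rho>) - ?p))
         (at ?p)"
    using nz assms by (intro tendsto_intros lim1) auto
  also have "1 / of_real \<rho> * ((-1) ^ n / fact n) * of_real x powr (- (of_real \<rho> * ?p)) / (of_real (l / \<rho>) - ?p) =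
             of_real ((-1) ^ n * x ^ n / (fact n * (l + real n)))"
  proof -
    have "complex_of_real x powr (- (of_real \<rho> * ?p)) = of_real (x ^ n)"
      using assms by (simp add: powr_nat')
    moreover have "of_real (l / \<rho>) - ?p = of_real ((l + real n) / \<rho>)" by (simp add: add_divide_distrib)
    moreover have "complex_of_real (l + real n) \<noteq> 0"
      using assms(2) by (subst of_real_eq_0_iff) linarith
    ultimately show ?thesis using assms by (simp add: field_simps)
  qed
  finally show ?thesis
  proof (rule Lim_transform_eventually)
    show "\<forall>\<^sub>F s in at ?p. 1 / of_real \<rho> * (Gamma (of_real \<rho> * s) * (of_real \<rho> * s + of_nat n)) *
              of_real x powr (- (of_real \<rho> * s)) / (of_real (l / \<rho>) - s) = (s - ?p) * mellin_kernel \<rho> l x s"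
    proof (rule always_eventually, rule allI)
      fix s
      have "of_real \<rho> * s + of_nat n = of_real \<rho> * (s - ?p)"
        using assms by (simp add: algebra_simps)
      thus "1 / of_real \<rho> * (Gamma (of_real \<rho> * s) * (of_real \<rho> * s + of_nat n)) *
              of_real x powr (- (of_real \<rho> * s)) / (of_real (l / \<rho>) - s) = (s - ?p) * mellin_kernel \<rho> l x s"
        using assms by (simp add: mellin_kernel_def)
    qed
  qed
qed

text \<open>The minus sign comes from the denominator l/\<rho> - s; the numerator is continuous
  there because \<rho> s = l > 0 is no pole of \<Gamma>.\<close>

lemma mellin_kernel_residue':
  assumes "\<rho> > 0" "l > 0" "x > 0"
  shows "((\<lambda>s. (s - of_real (l / \<rho>)) * mellin_kernel \<rho> l x s) \<longlongrightarrow>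
           - (Gamma (of_real l) * of_real x powr (- of_real l))) (at (of_real (l / \<rho>)))"
proof (rule Lim_transform_eventually)
  let ?p = "complex_of_real (l / \<rho>)"
  have *: "of_real \<rho> * ?p = of_real l" using assms by simp
  have "(complex_of_real l) \<notin> \<int>\<^sub>\<le>\<^sub>0" using assms by (auto elim!: nonpos_Ints_cases simp: complex_eq_iff)
  hence "((\<lambda>s. - (Gamma (of_real \<rho> * s) * of_real x powr (- (of_real \<rho> * s)))) \<longlongrightarrow>
         - (Gamma (of_real \<rho> * ?p) * of_real x powr (- (of_real \<rho> * ?p)))) (at ?p)"
    using assms unfolding * by (intro tendsto_intros) (auto intro!: tendsto_eq_intros)
  thus "((\<lambda>s. - (Gamma (of_real \<rho> * s) * of_real x powr (- (of_real \<rho> * s)))) \<longlongrightarrow>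
         - (Gamma (of_real l) * of_real x powr (- of_real l))) (at ?p)"
    unfolding * .
  show "\<forall>\<^sub>F s in at ?p. - (Gamma (of_real \<rho> * s) * of_real x powr (- (of_real \<rho> * s))) =
          (s - ?p) * mellin_kernel \<rho> l x s"
    using eventually_neq_at_within[of ?p ?p UNIV]
  proof eventually_elim
    case (elim s)
    have *: "(s - ?p) * (c / (?p - s)) = - c" for c
    proof -
      have "(s - ?p) / (?p - s) = - 1" using elim by (subst divide_eq_minus_1_iff) auto
      moreover have "(s - ?p) * (c / (?p - s)) = c * ((s - ?p) / (?p - s))"
        by (simp only: times_divide_eq_right mult.commute)
      ultimately show ?thesis by simp
    qed
    show ?case unfolding mellin_kernel_def * ..
  qed
qed

section \<open>Holomorphy and decay of the kernel\<close>

lemma mellin_kernel_holomorphic: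
  assumes "\<rho> > 0" "x > 0" "\<And>s. s \<in> A \<Longrightarrow> s \<noteq> of_real (l / \<rho>)" "\<And>s n. s \<in> A \<Longrightarrow> s \<noteq> of_real (- (real n / \<rho>))"
  shows "mellin_kernel \<rho> l x holomorphic_on A"
proof -
  have "of_real \<rho> * s \<notin> \<int>\<^sub>\<le>\<^sub>0" if "s \<in> A" for s
  proof
    assume "of_real \<rho> * s \<in> \<int>\<^sub>\<le>\<^sub>0"
    then obtain n where "of_real \<rho> * s = - of_nat n" by (auto elim: nonpos_Ints_cases')
    hence "s = of_real (- (real n / \<rho>))" using assms(1) by (intro of_real_mult_eq_minus_of_natD) auto
    thus False using assms(4)[OF that, of n] by simp
  qed
  moreover have "of_real (l / \<rho>) - s \<noteq> 0" if "s \<in> A" for s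
    using assms(3)[OF that] by auto
  ultimately show ?thesis
    unfolding mellin_kernel_def using assms(2) by (intro holomorphic_intros) auto
qed

text \<open>As a function of the exponent, the power increases for x \<ge> 1 and decreases for x
  \<le> 1; the sum of both endpoint values covers the two cases.\<close>

lemma powr_between:
  fixes x :: real
  assumes "x > 0" "y \<in> closed_segment a b"
  shows "x powr y \<le> x powr a + x powr b"
proof -
  have y: "min a b \<le> y" "y \<le> max a b"
    using assms(2) by (auto simp: closed_segment_eq_real_ivl split: if_splits)
  have "x powr y \<le> x powr (min a b) + x powr (max a b)"
  proof (cases "x \<ge> 1")
    case True thus ?thesis using powr_mono[OF y(2) True] by (simp add: add_increasing)
  next
    case False thus ?thesis using powr_mono'[OF y(1), of x] assms(1) by (simp add: add_increasing2)
  qed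
  thus ?thesis by (simp add: min_def max_def split: if_splits)
qed

text \<open>One factor 1/|Im s| comes from \<Gamma>, the other from the denominator, and the power
  of x is bounded on the strip. The square makes the kernel integrable along the straight ends of a
  contour. From \<rho> \<ge> 1 follows |Im (\<rho> s)| \<ge> |Im s| \<ge> 1.\<close>

lemma mellin_kernel_strip_bound:
  assumes "\<rho> \<ge> 1" "x > 0"
  obtains C where "\<And>s. \<lbrakk>Re s \<in> closed_segment a b; 1 \<le> \<bar>Im s\<bar>\<rbrakk> \<Longrightarrow> norm (mellin_kernel \<rho> l x s) \<le> C / (Im s)\<^sup>2"
proof -
  obtain C where C: "\<And>s::complex. \<lbrakk>Re s \<in> closed_segment (\<rho> * a) (\<rho> * b); 1 \<le> \<bar>Im s\<bar>\<rbrakk> \<Longrightarrow> norm (Gamma s) \<le> C / \<bar>Im s\<bar>"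
    using Gamma_strip_bound by blast
  define D where "D = x powr (- (\<rho> * a)) + x powr (- (\<rho> * b))"
  show ?thesis
  proof (rule that[of "C * D"])
    fix s assume s: "Re s \<in> closed_segment a b" "1 \<le> \<bar>Im s\<bar>"
    \<comment> \<open>Applied with c = \<rho> for the argument of \<Gamma> and c = -\<rho> for the
      exponent of x.\<close>
    have seg: "c * Re s \<in> closed_segment (c * a) (c * b)" for c
    proof -
      from s(1) obtain u where "0 \<le> u" "u \<le> 1" "Re s = (1 - u) * a + u * b"
        by (auto simp: in_segment)
      moreover from this(3) have "c * Re s = (1 - u) * (c * a) + u * (c * b)"
        by (simp only: ring_distribs mult.left_commute)
      ultimately show ?thesis by (auto simp: in_segment)
    qed
    have Im: "\<bar>Im s\<bar> \<le> \<rho> * \<bar>Im s\<bar>" using assms(1) mult_right_mono[of 1 \<rho> "\<bar>Im s\<bar>"] by simp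
    have G: "norm (Gamma (of_real \<rho> * s)) \<le> C / (\<rho> * \<bar>Im s\<bar>)"
      using C[of "of_real \<rho> * s"] seg[of \<rho>] Im s(2) assms(1) by (simp add: abs_mult)
    \<comment> \<open>\<open>C\<close> comes without a sign; it is nonnegative because a norm lies
      below C / (\<rho> |Im s|).\<close>
    hence "0 \<le> C / (\<rho> * \<bar>Im s\<bar>)" by (rule order_trans[OF norm_ge_zero])
    moreover have "0 < \<rho> * \<bar>Im s\<bar>" using s(2) Im by linarith
    ultimately have C0: "C \<ge> 0" by (meson divide_neg_pos not_le)
    have G: "norm (Gamma (of_real \<rho> * s)) \<le> C / \<bar>Im s\<bar>"
      by (rule order_trans[OF G]) (use C0 Im s(2) in \<open>intro frac_le; simp\<close>)
    have "norm (of_real x powr (- (of_real \<rho> * s))) = x powr (- (\<rho> * Re s))"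
      using assms(2) by (simp add: norm_powr_real_powr)
    also have "\<dots> \<le> D" unfolding D_def using powr_between[OF assms(2) seg[of "-\<rho>"]] by simp
    finally have P: "norm (of_real x powr (- (of_real \<rho> * s))) \<le> D" .
    have Q: "\<bar>Im s\<bar> \<le> norm (of_real (l / \<rho>) - s)"
      using abs_Im_le_cmod[of "of_real (l / \<rho>) - s"] by simp
    have "norm (mellin_kernel \<rho> l x s) \<le> (C / \<bar>Im s\<bar> * D) / \<bar>Im s\<bar>"
      unfolding mellin_kernel_def norm_divide norm_mult
      using G P Q C0 s(2) by (intro frac_le mult_mono) (auto simp: D_def)
    thus "norm (mellin_kernel \<rho> l x s) \<le> C * D / (Im s)\<^sup>2"
      by (simp add: power2_eq_square)
  qed
qed

text \<open>The bound for \<Gamma> and the distance to l/\<rho> are both measured against |1/2 +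
  it|, so together they give 1/(1/4 + t^2). The hypothesis \<rho> \<le> K keeps the line at distance
  at least 1/2 from l/\<rho>.\<close>

lemma mellin_kernel_line_bound:
  assumes "\<rho> \<ge> 1" "\<rho> \<le> real K" "l > 0" "x > 0"
  shows "norm (mellin_kernel \<rho> l x (Complex (- ((real K + 1/2) / \<rho>)) t)) \<le>
           sqrt pi * x powr (real K + 1/2) / fact K * inverse (1/4 + t\<^sup>2)"
proof -
  define s where "s = Complex (- ((real K + 1/2) / \<rho>)) t"
  define w where "w = Complex (1/2) t"
  have w: "norm w > 0" "(norm w)\<^sup>2 = 1/4 + t\<^sup>2"
    by (simp_all add: w_def complex_eq_iff cmod_power2 power_divide)
  have rs: "of_real \<rho> * s = Complex (- (real K + 1/2)) (\<rho> * t)"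
    using assms by (simp add: s_def complex_eq_iff)
  have "\<bar>t\<bar> \<le> \<bar>\<rho> * t\<bar>" using assms(1) mult_right_mono[of 1 \<rho> "\<bar>t\<bar>"] by (simp add: abs_mult)
  hence "norm w \<le> norm (Complex (1/2) (\<rho> * t))"
    unfolding w_def cmod_def by (intro real_sqrt_le_mono add_left_mono) (simp add: abs_le_square_iff)
  hence G: "norm (Gamma (of_real \<rho> * s)) \<le> sqrt pi / (fact K * norm w)"
    unfolding rs using w(1) by (intro order_trans[OF Gamma_left_line_bound] divide_left_mono mult_left_mono mult_pos_pos) auto
  have P: "norm (of_real x powr (- (of_real \<rho> * s))) = x powr (real K + 1/2)"
    using assms unfolding rs by (simp add: norm_powr_real_powr add.commute)
  have "1/2 \<le> l / \<rho> + (real K + 1/2) / \<rho>"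
    using assms by (simp add: field_simps)
  hence "norm w \<le> norm (of_real (l / \<rho>) - s)"
    unfolding w_def s_def cmod_def using power_mono[of "1/2" "l / \<rho> + (real K + 1/2) / \<rho>" 2]
    by (intro real_sqrt_le_mono) simp
  hence "norm (mellin_kernel \<rho> l x s) \<le> (sqrt pi / (fact K * norm w) * x powr (real K + 1/2)) / norm w"
    unfolding mellin_kernel_def norm_divide norm_mult P
    using G w(1) by (intro frac_le mult_mono) auto
  also have "\<dots> = sqrt pi * x powr (real K + 1/2) / fact K * inverse ((norm w)\<^sup>2)"
    using w(1) by (simp add: field_simps power2_eq_square)
  finally show ?thesis unfolding w(2) s_def .
qed

text \<open>A compact middle piece plus straight ends on one vertical line. Thus for large K the
  whole contour lies in the half-plane on which the residues are compared.\<close>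

lemma upward_contour_Re_bounded_below:
  assumes "upward_contour L"
  obtains B where "\<And>t. B < Re (L t)"
proof -
  obtain c T where T: "T > 0" "\<And>t. \<bar>t\<bar> \<ge> T \<Longrightarrow> L t = Complex c t"
    using upward_contourD[OF assms] by blast
  have "L piecewise_C1_differentiable_on {-T..T}"
    using assms T(1) by (auto simp: upward_contour_def)
  hence "continuous_on {-T..T} L" by (simp add: piecewise_C1_differentiable_on_def)
  hence "bounded (L ` {-T..T})" by (intro compact_imp_bounded compact_continuous_image) auto
  then obtain M where "\<forall>z\<in>L ` {-T..T}. norm z \<le> M" by (auto simp: bounded_iff)
  hence M: "\<And>t. t \<in> {-T..T} \<Longrightarrow> norm (L t) \<le> M" by blast
  show ?thesis
  proof (rule that[of "min c (- M) - 1"])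
    fix t show "min c (- M) - 1 < Re (L t)"
    proof (cases "t \<in> {-T..T}")
      case True
      have "- Re (L t) \<le> M" using M[OF True] abs_Re_le_cmod[of "L t"] by linarith
      thus ?thesis by linarith
    next
      case False
      thus ?thesis using T(2)[of t] by auto
    qed
  qed
qed

text \<open>The antiderivative is 2 arctan (2t). The value stays below 2 pi, which makes the
  estimate of the line integrals uniform in R.\<close>

lemma has_integral_lorentzian:
  assumes "R \<ge> 0"
  shows "((\<lambda>t::real. inverse (1/4 + t\<^sup>2)) has_integral (4 * arctan (2 * R))) {-R..R}"
proof -
  have "((\<lambda>t::real. inverse (1/4 + t\<^sup>2)) has_integral (2 * arctan (2 * R) - 2 * arctan (2 * (-R)))) {-R..R}"
  proof (rule fundamental_theorem_of_calculus)
    fix t :: real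
    have "1 + 4 * t\<^sup>2 > 0" by (simp add: add_pos_nonneg)
    hence "((\<lambda>t. 2 * arctan (2 * t)) has_real_derivative inverse (1/4 + t\<^sup>2)) (at t within {-R..R})"
      by (auto intro!: derivative_eq_intros simp: divide_simps power_mult_distrib)
    thus "((\<lambda>t. 2 * arctan (2 * t)) has_vector_derivative inverse (1/4 + t\<^sup>2)) (at t within {-R..R})"
      by (simp add: has_real_derivative_iff_has_vector_derivative)
  qed (use assms in auto)
  thus ?thesis by (simp add: arctan_minus)
qed

lemma mellin_kernel_line_integral_bound:
  assumes "\<rho> \<ge> 1" "\<rho> \<le> real K" "l > 0" "x > 0" "R > 0"
  shows "norm (contour_integral (symm_arc (Complex (- ((real K + 1/2) / \<rho>))) R) (mellin_kernel \<rho> l x)) \<le>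
           sqrt pi * x powr (real K + 1/2) / fact K * (2 * pi)"
proof -
  define \<sigma> where "\<sigma> = - ((real K + 1/2) / \<rho>)"
  define B where "B = sqrt pi * x powr (real K + 1/2) / fact K"
  define J where "J = contour_integral (symm_arc (Complex \<sigma>) R) (mellin_kernel \<rho> l x)"
  have "\<sigma> < 0" using assms(1) by (simp add: \<sigma>_def)
  have "mellin_kernel \<rho> l x holomorphic_on
          UNIV - (insert (of_real (l / \<rho>)) (range (\<lambda>n. complex_of_real (- (real n / \<rho>)))))"
    using assms by (intro mellin_kernel_holomorphic) auto
  hence hol: "mellin_kernel \<rho> l x holomorphic_on range (Complex \<sigma>)"
  proof (rule holomorphic_on_subset, safe)
    fix t assume "Complex \<sigma> t = of_real (l / \<rho>)"
    hence "\<sigma> = l / \<rho>" by (simp add: complex_eq_iff)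
    moreover have "l / \<rho> > 0" using assms by simp
    ultimately show False using \<open>\<sigma> < 0\<close> by simp
  next
    \<comment> \<open>The line avoids the poles -n/\<rho> by parity: 2K + 1 is odd.\<close>
    fix t n assume "Complex \<sigma> t = of_real (- (real n / \<rho>))"
    hence "real K + 1/2 = real n" using assms by (auto simp: complex_eq_iff \<sigma>_def)
    hence "real (2 * K + 1) = real (2 * n)" by simp
    hence "2 * K + 1 = 2 * n" by (simp only: of_nat_eq_iff)
    thus False by presburger
  qed auto
  have "continuous_on {-R..R} (\<lambda>t. mellin_kernel \<rho> l x (Complex \<sigma> t))"
  proof (rule continuous_on_compose2[OF holomorphic_on_imp_continuous_on[OF hol]])
    show "continuous_on {-R..R} (Complex \<sigma>)"
      unfolding Complex_eq[abs_def] by (intro continuous_intros)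
  qed auto
  hence "(\<lambda>t. mellin_kernel \<rho> l x (Complex \<sigma> t) * \<i>) integrable_on {-R..R}"
    by (intro integrable_continuous_interval continuous_intros)
  then obtain I where I: "((\<lambda>t. mellin_kernel \<rho> l x (Complex \<sigma> t) * \<i>) has_integral I) {-R..R}"
    by blast
  hence "(mellin_kernel \<rho> l x has_contour_integral I) (symm_arc (Complex \<sigma>) R)"
    using assms(5) by (simp add: has_contour_integral_symm_arc upward_contour_Complex)
  hence "I = J" unfolding J_def by (simp add: contour_integral_unique)
  have bnd: "((\<lambda>t. B * inverse (1/4 + t\<^sup>2)) has_integral B * (4 * arctan (2 * R))) {-R..R}"
    using assms by (intro has_integral_mult_right has_integral_lorentzian) auto
  \<comment> \<open>The component form of the estimate compares a complex integral with a real
    majorant; on the reals the inner product with 1 is the number itself.\<close>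
  have "norm I \<le> (B * (4 * arctan (2 * R))) \<bullet> 1"
  proof (rule has_integral_norm_bound_integral_component[OF I bnd])
    fix t
    show "norm (mellin_kernel \<rho> l x (Complex \<sigma> t) * \<i>) \<le> (B * inverse (1/4 + t\<^sup>2)) \<bullet> 1"
      using mellin_kernel_line_bound[OF assms(1-4), of t] by (simp add: norm_mult \<sigma>_def B_def)
  qed
  hence "norm J \<le> B * (4 * arctan (2 * R))" using \<open>I = J\<close> by simp
  also have "\<dots> \<le> B * (2 * pi)"
    using arctan_ubound[of "2 * R"] assms by (intro mult_left_mono) (auto simp: B_def)
  finally show ?thesis unfolding J_def B_def \<sigma>_def .
qed

section \<open>The line recedes to the left: the integral as a residue series\<close>

lemma power_half_over_fact_tendsto_0:
  fixes x :: real assumes "x > 0"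
  shows "((\<lambda>K. sqrt pi * x powr (real K + 1/2) / fact K * (2 * pi)) \<longlongrightarrow> 0) sequentially"
proof -
  have "((\<lambda>K. inverse (fact K) * x ^ K) \<longlongrightarrow> 0) sequentially"
    by (rule summable_LIMSEQ_zero[OF summable_exp])
  hence "((\<lambda>K. (sqrt pi * x powr (1/2) * (2 * pi)) * (inverse (fact K) * x ^ K)) \<longlongrightarrow>
           (sqrt pi * x powr (1/2) * (2 * pi)) * 0) sequentially"
    by (intro tendsto_intros)
  also have "(\<lambda>K. (sqrt pi * x powr (1/2) * (2 * pi)) * (inverse (fact K) * x ^ K)) =
             (\<lambda>K. sqrt pi * x powr (real K + 1/2) / fact K * (2 * pi))"
  proof
    fix K
    have "x powr (real K + 1/2) = x ^ K * x powr (1/2)"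
      using assms by (simp only: powr_add powr_realpow)
    thus "(sqrt pi * x powr (1/2) * (2 * pi)) * (inverse (fact K) * x ^ K) =
            sqrt pi * x powr (real K + 1/2) / fact K * (2 * pi)"
      by (simp only: divide_inverse mult_ac)
  qed
  finally show ?thesis by simp
qed

text \<open>The arc integrals along \<open>L\<close> converge by hypothesis, hence so do those along
  the line at -(K + 1/2)/\<rho>, to \<open>I\<close> minus the residues passed. This limit inherits
  the bound that is uniform in R, and the bound tends to 0 with growing K.\<close>

lemma mellin_kernel_arc_limit:
  assumes \<rho>: "\<rho> \<ge> 1" and pos: "l > 0" "x > 0" and L: "upward_contour L"
    and left: "\<And>n. left_of L (of_real (- (real n / \<rho>)))"
    and right: "right_of L (of_real (l / \<rho>))"
    and lim: "((\<lambda>R. contour_integral (symm_arc L R) (mellin_kernel \<rho> l x)) \<longlongrightarrow> I) at_top"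
  shows "((\<lambda>K. 2 * of_real pi * \<i> * (\<Sum>n\<le>K. of_real ((-1) ^ n * x ^ n / (fact n * (l + real n))))) \<longlongrightarrow> I)
           sequentially"
proof -
  define F where "F = mellin_kernel \<rho> l x"
  define pole where "pole = (\<lambda>n. complex_of_real (- (real n / \<rho>)))"
  define q where "q = complex_of_real (l / \<rho>)"
  define a where "a = (\<lambda>n. complex_of_real ((-1) ^ n * x ^ n / (fact n * (l + real n))))"
  have inj: "inj pole" using \<rho> by (auto simp: inj_def pole_def)
  have "l / \<rho> > 0" using \<rho> pos by simp
  moreover have "- (real n / \<rho>) \<le> 0" for n using \<rho> by simp
  ultimately have q: "pole n \<noteq> q" for n
    unfolding pole_def q_def of_real_eq_iff by (metis not_le)
  \<comment> \<open>Residues as a function of the point: \<open>pole\<close> is injective, so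
    \<open>inv pole\<close> recovers the index n.\<close>
  define c where "c = (\<lambda>p. if p = q then - (Gamma (of_real l) * of_real x powr (- of_real l)) else a (inv pole p))"
  define w where "w = (\<lambda>p. if p = q then - 1 / 2 else 1 / 2 :: complex)"
  obtain B where B: "\<And>t. B < Re (L t)" using upward_contour_Re_bounded_below[OF L] by blast
  \<comment> \<open>Of the two conditions on \<open>K\<close>, the first is for the line estimate
    and the second puts \<open>L\<close> to the right of -(K + 1)/\<rho>.\<close>
  have bound: "norm (I - 2 * of_real pi * \<i> * (\<Sum>n\<le>K. a n)) \<le>
                 sqrt pi * x powr (real K + 1/2) / fact K * (2 * pi)"
    if K: "\<rho> \<le> real K" "- B * \<rho> \<le> real K" for K
  proof -
    define \<sigma> where "\<sigma> = - ((real K + 1/2) / \<rho>)"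
    \<comment> \<open>The edge of \<open>S\<close> passes through the left pole number K + 1, so
      \<open>S\<close> contains q and precisely the left poles with n \<le> K; the line at \<sigma>
      runs strictly between the poles K and K + 1.\<close>
    define S where "S = {s. - ((real K + 1) / \<rho>) < Re s}"
    define pts where "pts = insert q (pole ` {..K})"
    have pole_\<sigma>: "\<sigma> < - (real n / \<rho>)" "- ((real K + 1) / \<rho>) < - (real n / \<rho>)" if "n \<le> K" for n
      using that \<rho> by (auto simp: \<sigma>_def divide_strict_right_mono)
    have "\<sigma> < 0" "- ((real K + 1) / \<rho>) < 0" using \<rho> by (auto simp: \<sigma>_def)
    have "- ((real K + 1) / \<rho>) < B" using K(2) \<rho> by (simp add: field_simps)
    have "((\<lambda>R. contour_integral (symm_arc L R) F - contour_integral (symm_arc (Complex \<sigma>) R) F) \<longlongrightarrow>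
           2 * of_real pi * \<i> * (\<Sum>p\<in>pts. c p * (w p - (- 1 / 2)))) at_top"
    proof (rule contour_shift)
      show "open S" unfolding S_def by (rule open_halfspace_Re_gt)
      show "convex S" unfolding S_def by (rule convex_halfspace_Re_gt)
      show "finite pts" by (simp add: pts_def)
      show "pts \<subseteq> \<real>" by (auto simp: pts_def q_def pole_def)
      show "pts \<subseteq> S"
        using pole_\<sigma>(2) \<open>- ((real K + 1) / \<rho>) < 0\<close> \<open>l / \<rho> > 0\<close>
        by (auto simp: pts_def S_def q_def pole_def intro: less_trans)
      show "F holomorphic_on S - pts"
        unfolding F_def
      proof (rule mellin_kernel_holomorphic)
        fix s n assume s: "s \<in> S - pts"
        show "s \<noteq> of_real (- (real n / \<rho>))"
        proof
          assume *: "s = of_real (- (real n / \<rho>))"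
          hence "- ((real K + 1) / \<rho>) < - (real n / \<rho>)" using s by (simp add: S_def)
          hence "n \<le> K" using \<rho> by (simp add: divide_less_cancel)
          thus False using s * by (auto simp: pts_def pole_def)
        qed
      qed (use \<rho> pos in \<open>auto simp: pts_def q_def\<close>)
      show "((\<lambda>s. (s - p) * F s) \<longlongrightarrow> c p) (at p)" if "p \<in> pts" for p
      proof (cases "p = q")
        case True
        thus ?thesis using mellin_kernel_residue'[of \<rho> l x] \<rho> pos by (simp add: F_def c_def q_def)
      next
        case False
        then obtain n where "p = pole n" using \<open>p \<in> pts\<close> by (auto simp: pts_def)
        moreover have "((\<lambda>s. (s - pole n) * F s) \<longlongrightarrow> a n) (at (pole n))"
          unfolding F_def pole_def a_def using \<rho> pos by (intro mellin_kernel_residue) auto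
        moreover have "c (pole n) = a n" using q[of n] inj by (simp add: c_def)
        ultimately show ?thesis by simp
      qed
      show "range L \<subseteq> S" using B \<open>- ((real K + 1) / \<rho>) < B\<close> by (auto simp: S_def intro: less_trans)
      show "range (Complex \<sigma>) \<subseteq> S" using \<rho> by (auto simp: S_def \<sigma>_def divide_strict_right_mono)
      show "index_along L p (w p)" if "p \<in> pts" for p
        using that left right q by (auto simp: pts_def w_def q_def pole_def left_of_def right_of_def)
      show "index_along (Complex \<sigma>) p (- 1 / 2)" if "p \<in> pts" for p
        using that pole_\<sigma>(1) \<open>\<sigma> < 0\<close> \<open>l / \<rho> > 0\<close>
        by (intro index_along_Complex_right) (auto simp: pts_def q_def pole_def)
      show "\<exists>C. \<forall>s. Re s \<in> closed_segment a b \<longrightarrow> 1 \<le> \<bar>Im s\<bar> \<longrightarrow> norm (F s) \<le> C / \<bar>Im s\<bar>" for a b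
      proof -
        obtain C where C: "\<And>s. \<lbrakk>Re s \<in> closed_segment a b; 1 \<le> \<bar>Im s\<bar>\<rbrakk> \<Longrightarrow> norm (F s) \<le> C / (Im s)\<^sup>2"
          using mellin_kernel_strip_bound[OF \<rho> pos(2)] unfolding F_def by blast
        have "norm (F s) \<le> \<bar>C\<bar> / \<bar>Im s\<bar>" if s: "Re s \<in> closed_segment a b" "1 \<le> \<bar>Im s\<bar>" for s
        proof -
          have "\<bar>Im s\<bar> \<le> \<bar>Im s\<bar> ^ 2" using s(2) by (rule self_le_power) auto
          hence "C / (Im s)\<^sup>2 \<le> \<bar>C\<bar> / \<bar>Im s\<bar>" using s(2) by (intro frac_le) auto
          thus ?thesis using C[OF s] by linarith
        qed
        thus ?thesis by blast
      qed
    qed (fact L upward_contour_Complex)+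
    \<comment> \<open>The weights are 1/2 + 1/2 = 1 at the left poles and -1/2 + 1/2 = 0 at q, which
      therefore drops out.\<close>
    also have "(\<Sum>p\<in>pts. c p * (w p - (- 1 / 2))) = (\<Sum>n\<le>K. a n)"
    proof -
      have "q \<notin> pole ` {..K}" using q by auto
      hence "(\<Sum>p\<in>pts. c p * (w p - (- 1 / 2))) = (\<Sum>p\<in>pole ` {..K}. c p * (w p - (- 1 / 2)))"
        unfolding pts_def by (subst sum.insert) (auto simp: w_def)
      also have "\<dots> = (\<Sum>n\<le>K. c (pole n) * (w (pole n) - (- 1 / 2)))"
        by (subst sum.reindex) (auto intro: inj_on_subset[OF inj])
      also have "\<dots> = (\<Sum>n\<le>K. a n)"
        using q inj by (intro sum.cong) (auto simp: c_def w_def)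
      finally show ?thesis .
    qed
    finally have "((\<lambda>R. contour_integral (symm_arc L R) F -
        (contour_integral (symm_arc L R) F - contour_integral (symm_arc (Complex \<sigma>) R) F)) \<longlongrightarrow>
           I - 2 * of_real pi * \<i> * (\<Sum>n\<le>K. a n)) at_top"
      by (intro tendsto_diff lim[folded F_def])
    hence "((\<lambda>R. contour_integral (symm_arc (Complex \<sigma>) R) F) \<longlongrightarrow>
             I - 2 * of_real pi * \<i> * (\<Sum>n\<le>K. a n)) at_top" by simp
    thus ?thesis
    proof (rule Lim_norm_ubound[rotated])
      show "\<forall>\<^sub>F R in at_top. norm (contour_integral (symm_arc (Complex \<sigma>) R) F) \<le>
              sqrt pi * x powr (real K + 1/2) / fact K * (2 * pi)"
        using eventually_gt_at_top[of 0] unfolding F_def \<sigma>_def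
        by eventually_elim (rule mellin_kernel_line_integral_bound[OF \<rho> K(1) pos])
    qed auto
  qed
  have "((\<lambda>K. 2 * of_real pi * \<i> * (\<Sum>n\<le>K. a n) - I) \<longlongrightarrow> 0) sequentially"
  proof (rule Lim_null_comparison[OF _ power_half_over_fact_tendsto_0[OF pos(2)]])
    have "\<forall>\<^sub>F K in sequentially. max \<rho> (- B * \<rho>) \<le> real K"
      using filterlim_real_sequentially unfolding filterlim_at_top by blast
    thus "\<forall>\<^sub>F K in sequentially. norm (2 * of_real pi * \<i> * (\<Sum>n\<le>K. a n) - I) \<le>
            sqrt pi * x powr (real K + 1/2) / fact K * (2 * pi)"
      by eventually_elim (subst norm_minus_commute, rule bound, auto)
  qed
  thus ?thesis unfolding a_def by (rule LIM_zero_cancel)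
qed

text \<open>Quadratic decay on the straight ends makes the improper integral exist, so it is the
  limit of its symmetric truncations, and uniqueness of limits identifies it with the residue
  series.\<close>

lemma mellin_kernel_integral:
  assumes \<rho>: "\<rho> \<ge> 1" and pos: "l > 0" "x > 0" and L: "upward_contour L"
    and left: "\<And>n. left_of L (of_real (- (real n / \<rho>)))"
    and right: "right_of L (of_real (l / \<rho>))"
    and sums: "(\<lambda>n. (-1) ^ n * x ^ n / (fact n * (l + real n))) sums S"
  shows "integral UNIV (\<lambda>t. mellin_kernel \<rho> l x (L t) * vector_derivative L (at t)) = 2 * of_real pi * \<i> * of_real S"
proof -
  define f where "f = (\<lambda>t. mellin_kernel \<rho> l x (L t) * vector_derivative L (at t))"
  \<comment> \<open>Written as a preimage, the pole set is visibly closed; its complement is an open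
    set that contains the arcs and on which the kernel is holomorphic.\<close>
  define poles where "poles = insert (complex_of_real (l / \<rho>)) ((\<lambda>s. of_real \<rho> * s) -` \<int>\<^sub>\<le>\<^sub>0)"
  have "closed poles"
    unfolding poles_def by (intro closed_insert closed_vimage closed_nonpos_Ints continuous_intros)
  have poles: "of_real (- (real n / \<rho>)) \<in> poles" for n
    using \<rho> by (simp add: poles_def)
  have poles': "p = of_real (l / \<rho>) \<or> (\<exists>n. p = of_real (- (real n / \<rho>)))" if "p \<in> poles" for p
    using that \<rho> of_real_mult_eq_minus_of_natD[of \<rho> p] unfolding poles_def
    by (force elim!: nonpos_Ints_cases')
  have arc: "(f has_integral contour_integral (symm_arc L R) (mellin_kernel \<rho> l x)) {-R..R}" if R: "R > 0" for R
  proof -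
    have "mellin_kernel \<rho> l x contour_integrable_on (symm_arc L R)"
    proof (rule contour_integrable_holomorphic_simple)
      show "mellin_kernel \<rho> l x holomorphic_on - poles"
        using \<rho> pos poles by (intro mellin_kernel_holomorphic) (auto simp: poles_def)
      show "open (- poles)" using \<open>closed poles\<close> by (simp add: open_Compl)
      show "path_image (symm_arc L R) \<subseteq> - poles"
      proof -
        have "of_real (- (real n / \<rho>)) \<notin> range L" for n
          using left[of n] unfolding left_of_def index_along_def by (rule conjunct1)
        moreover have "of_real (l / \<rho>) \<notin> range L"
          using right unfolding right_of_def index_along_def by (rule conjunct1)
        ultimately have "p \<notin> range L" if "p \<in> poles" for p
          using poles'[OF that] by metis
        thus ?thesis unfolding path_image_symm_arc[OF R] by blast
      qed
    qed (rule valid_path_symm_arc[OF L R])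
    from has_contour_integral_integral[OF this] show ?thesis
      unfolding has_contour_integral_symm_arc[OF L R] f_def .
  qed
  obtain c T where T: "T > 0" "\<And>t. \<bar>t\<bar> \<ge> T \<Longrightarrow> L t = Complex c t"
    using upward_contourD[OF L] by blast
  \<comment> \<open>The degenerate segment from c to c stands for the single line that carries both
    ends of \<open>L\<close>.\<close>
  obtain C where C: "\<And>s. \<lbrakk>Re s \<in> closed_segment c c; 1 \<le> \<bar>Im s\<bar>\<rbrakk> \<Longrightarrow> norm (mellin_kernel \<rho> l x s) \<le> C / (Im s)\<^sup>2"
    using mellin_kernel_strip_bound[OF \<rho> pos(2)] by blast
  have "f integrable_on UNIV"
  \<comment> \<open>T + 1 in place of T gives |t| \<ge> 1 for the decay and a neighbourhood of t on
    which \<open>L\<close> is straight, so that its derivative there is i.\<close>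
  proof (rule integrable_on_UNIV_if_square_decay[of _ "T + 1"])
    fix t assume t: "T + 1 \<le> \<bar>t\<bar>"
    have "vector_derivative L (at t) = \<i>"
    proof (rule vector_derivative_at, rule has_vector_derivative_transform_within_open)
      show "(Complex c has_vector_derivative \<i>) (at t)"
        unfolding Complex_eq[abs_def] by (auto intro!: derivative_eq_intros)
      show "open (- {- T..T})" by (simp add: open_Compl)
      show "t \<in> - {- T..T}" using t by auto
      show "Complex c s = L s" if "s \<in> - {- T..T}" for s using T(2)[of s] that by auto
    qed
    thus "norm (f t) \<le> C / t\<^sup>2"
      using C[of "Complex c t"] T t by (simp add: f_def norm_mult)
  qed (use arc T in \<open>auto simp: integrable_on_def\<close>)
  hence "((\<lambda>R. integral {-R..R} f) \<longlongrightarrow> integral UNIV f) at_top"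
    by (rule integral_UNIV_symmetric_limit)
  moreover have "\<forall>\<^sub>F R in at_top. integral {-R..R} f = contour_integral (symm_arc L R) (mellin_kernel \<rho> l x)"
    using eventually_gt_at_top[of 0] by eventually_elim (use arc in \<open>auto simp: integral_unique\<close>)
  ultimately have "((\<lambda>R. contour_integral (symm_arc L R) (mellin_kernel \<rho> l x)) \<longlongrightarrow> integral UNIV f) at_top"
    by (rule Lim_transform_eventually)
  from mellin_kernel_arc_limit[OF \<rho> pos L left right this]
  have lim: "(\<lambda>K. 2 * of_real pi * \<i> * (\<Sum>n\<le>K. of_real ((-1) ^ n * x ^ n / (fact n * (l + real n)))))
           \<longlonglongrightarrow> integral UNIV f" .
  from sums have "(\<lambda>n. complex_of_real ((-1) ^ n * x ^ n / (fact n * (l + real n)))) sums of_real S"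
    by (rule sums_of_real)
  hence "(\<lambda>K. 2 * of_real pi * \<i> * (\<Sum>n\<le>K. complex_of_real ((-1) ^ n * x ^ n / (fact n * (l + real n)))))
           \<longlonglongrightarrow> 2 * of_real pi * \<i> * of_real S"
    unfolding sums_def_le by (intro tendsto_intros)
  from LIMSEQ_unique[OF lim this] show ?thesis unfolding f_def .
qed

section \<open>The lower incomplete Gamma function and the outage probability\<close>

text \<open>For x > 0 this is x^(-l) times the lower incomplete Gamma function; unlike that quotient
  it makes sense at 0. Coefficients and powers are kept apart for termwise differentiation.\<close>

definition incgamma_series :: "real \<Rightarrow> real \<Rightarrow> real" where
  "incgamma_series l x = (\<Sum>n. (-1) ^ n / (fact n * (l + real n)) * x ^ n)"

lemma summable_incgamma_series:
  assumes "l > 0"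
  shows "summable (\<lambda>n. (-1) ^ n / (fact n * (l + real n)) * x ^ n)"
proof (rule summable_comparison_test')
  show "summable (\<lambda>n. 1 / l * (inverse (fact n) * \<bar>x\<bar> ^ n))"
    by (intro summable_mult summable_exp)
  fix n :: nat
  have "norm ((-1) ^ n / (fact n * (l + real n)) * x ^ n) = 1 / (l + real n) * (inverse (fact n) * \<bar>x\<bar> ^ n)"
    using assms by (simp add: norm_mult norm_divide power_abs divide_inverse abs_mult)
  also have "\<dots> \<le> 1 / l * (inverse (fact n) * \<bar>x\<bar> ^ n)"
    using assms by (intro mult_right_mono frac_le) auto
  finally show "norm ((-1) ^ n / (fact n * (l + real n)) * x ^ n) \<le> 1 / l * (inverse (fact n) * \<bar>x\<bar> ^ n)" .
qed

text \<open>Since (l + n) c_n = (-1)^n / n!, the operator l + x d/dx turns the series into that of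
  exp (-x). For x > 0 this says (x^l f)' = x^(l-1) e^(-x), but in a form free of real
  powers.\<close>

lemma incgamma_series_deriv:
  assumes "l > 0"
  obtains D where "(incgamma_series l has_real_derivative D) (at x)"
    "l * incgamma_series l x + x * D = exp (- x)"
proof -
  define c where "c = (\<lambda>n. (-1) ^ n / (fact n * (l + real n)))"
  have c: "c n * (l + real n) = (-1) ^ n / fact n" for n
  proof -
    have "l + real n \<noteq> 0" using assms by linarith
    thus ?thesis by (simp add: c_def)
  qed
  have sm: "summable (\<lambda>n. c n * y ^ n)" for y
    unfolding c_def by (rule summable_incgamma_series[OF assms])
  have eq: "incgamma_series l = (\<lambda>y. \<Sum>n. c n * y ^ n)"
    by (simp add: fun_eq_iff incgamma_series_def c_def)
  have D: "(incgamma_series l has_real_derivative (\<Sum>n. diffs c n * x ^ n)) (at x)"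
    unfolding eq by (rule termdiffs_strong_converges_everywhere[OF sm])
  have "(\<lambda>n. of_nat n * c n * x ^ (n - Suc 0)) sums (\<Sum>n. diffs c n * x ^ n)"
    by (rule diffs_equiv, rule termdiff_converges_all[OF sm])
  hence "(\<lambda>n. x * (of_nat n * c n * x ^ (n - Suc 0))) sums (x * (\<Sum>n. diffs c n * x ^ n))"
    by (rule sums_mult)
  moreover have "x * (of_nat n * c n * x ^ (n - Suc 0)) = real n * c n * x ^ n" for n
    by (cases n) auto
  ultimately have 1: "(\<lambda>n. real n * c n * x ^ n) sums (x * (\<Sum>n. diffs c n * x ^ n))" by simp
  have "(\<lambda>n. l * (c n * x ^ n)) sums (l * incgamma_series l x)"
    unfolding eq by (intro sums_mult summable_sums sm)
  from sums_add[OF this 1]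
  have "(\<lambda>n. c n * (l + real n) * x ^ n) sums (l * incgamma_series l x + x * (\<Sum>n. diffs c n * x ^ n))"
    by (simp add: algebra_simps)
  moreover have "(\<lambda>n. c n * (l + real n) * x ^ n) = (\<lambda>n. (- x) ^ n /\<^sub>R fact n)"
    unfolding c by (simp add: fun_eq_iff power_minus[of x] divide_inverse)
  ultimately have "l * incgamma_series l x + x * (\<Sum>n. diffs c n * x ^ n) = exp (- x)"
    using exp_converges[of "- x"] by (metis sums_unique2)
  with D show ?thesis using that by blast
qed

lemma isCont_incgamma_series: "l > 0 \<Longrightarrow> isCont (incgamma_series l) x"
  by (meson incgamma_series_deriv DERIV_isCont)

text \<open>By the differential equation of the series f, the function (y/k)^l f(y/k) / \<Gamma>(l)
  is an antiderivative of the density on y > 0, and it vanishes at 0.\<close>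

lemma gamma_density_integral:
  assumes "l > 0" "k > 0" "X \<ge> 0"
  shows "(gamma_density l k has_integral ((X / k) powr l * incgamma_series l (X / k) / Gamma l)) {0..X}"
proof -
  let ?S = "\<lambda>y. (y / k) powr l * incgamma_series l (y / k) / Gamma l"
  have cont: "continuous_on UNIV (incgamma_series l)"
    using isCont_incgamma_series[OF assms(1)] by (simp add: continuous_at_imp_continuous_on)
  have "(gamma_density l k has_integral (?S X - ?S 0)) {0..X}"
  \<comment> \<open>For l < 1 the density is unbounded near 0 and the antiderivative is not
    differentiable there; the interior form asks only for continuity at the endpoints.\<close>
  proof (rule fundamental_theorem_of_calculus_interior)
    show "continuous_on {0..X} ?S"
    proof (intro continuous_on_divide continuous_on_mult continuous_on_powr' continuous_on_const continuous_on_id)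
      show "continuous_on {0..X} (\<lambda>y. incgamma_series l (y / k))"
        by (rule continuous_on_compose2[OF cont]) (use assms in \<open>auto intro!: continuous_intros\<close>)
    qed (use assms in \<open>auto simp: Gamma_eq_zero_iff elim!: nonpos_Ints_cases\<close>)
    fix y assume y: "y \<in> {0<..<X}"
    obtain D where D: "(incgamma_series l has_real_derivative D) (at (y / k))"
      "l * incgamma_series l (y / k) + y / k * D = exp (- (y / k))"
      using incgamma_series_deriv[OF assms(1)] by blast
    have D1: "((\<lambda>y. incgamma_series l (y / k)) has_real_derivative D * (1 / k)) (at y)"
      by (rule DERIV_chain2[of "incgamma_series l" D "\<lambda>y. y / k" y "1 / k"])
         (use D(1) assms in \<open>auto intro!: derivative_eq_intros\<close>)
    have D2: "((\<lambda>y. (y / k) powr l) has_real_derivative l * (y / k) powr (l - 1) * (1 / k)) (at y)"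
      by (rule DERIV_fun_powr[THEN DERIV_cong]) (use assms y in \<open>auto intro!: derivative_eq_intros\<close>)
    have "(?S has_real_derivative
            ((l * (y / k) powr (l - 1) * (1 / k)) * incgamma_series l (y / k) +
             (D * (1 / k)) * (y / k) powr l) / Gamma l) (at y)"
      by (intro DERIV_cdivide DERIV_mult D1 D2)
    also have "((l * (y / k) powr (l - 1) * (1 / k)) * incgamma_series l (y / k) +
             (D * (1 / k)) * (y / k) powr l) / Gamma l =
             (y / k) powr (l - 1) * (1 / k) * (l * incgamma_series l (y / k) + y / k * D) / Gamma l"
    proof -
      have "(y / k) powr l = (y / k) powr (l - 1) * (y / k)"
        using powr_add[of "y / k" "l - 1" 1] y assms by simp
      thus ?thesis by (simp only: ring_distribs mult_ac)
    qed
    also have "\<dots> = gamma_density l k y"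
    proof -
      have "(y / k) powr (l - 1) * (1 / k) = y powr (l - 1) / k powr l"
        using y assms powr_add[of k "l - 1" 1] by (simp add: powr_divide)
      thus ?thesis unfolding D(2) using y by (simp add: gamma_density_def)
    qed
    finally show "(?S has_vector_derivative gamma_density l k y) (at y)"
      by (simp add: has_real_derivative_iff_has_vector_derivative)
  qed (use assms in auto)
  thus ?thesis using assms by simp
qed

text \<open>The event reads \<open>Mbar\<close> \<le> X only on the positive axis: for r = 2 the SNR
  is even, so large negative arguments fall outside the event, and for r = 1 all of them fall
  inside. The density vanishes there, so {0..X} may replace the event in both cases.\<close>

lemma outage_prob_eq:
  assumes Q: "distributed Q lborel Mbar (\<lambda>y. ennreal (gamma_density l k y))"
    and pos: "l > 0" "k > 0" "E > 0" "g > 0" "\<mu> > 0" and r: "r \<ge> 1"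
  defines "x \<equiv> E / k * (g / \<mu>) powr (1 / real r)"
  shows "outage_prob Q Mbar r E g \<mu> = x powr l * incgamma_series l x / Gamma l"
proof -
  define X where "X = E * (g / \<mu>) powr (1 / real r)"
  have X: "X > 0" using pos by (simp add: X_def)
  define A where "A = {y. snr r E \<mu> y \<le> g}"
  have A: "A \<in> sets lborel"
  proof -
    have "closed A" unfolding A_def snr_def
      using pos by (intro closed_Collect_le continuous_intros) auto
    thus ?thesis by simp
  qed
  have iff: "snr r E \<mu> y \<le> g \<longleftrightarrow> y \<le> X" if "y > 0" for y
  proof -
    have "snr r E \<mu> y \<le> g \<longleftrightarrow> (y / E) ^ r \<le> g / \<mu>"
      using pos by (simp add: snr_def field_simps)
    also have "g / \<mu> = ((g / \<mu>) powr (1 / real r)) ^ r"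
      using pos r by (simp add: powr_powr flip: powr_realpow)
    also have "(y / E) ^ r \<le> \<dots> \<longleftrightarrow> y / E \<le> (g / \<mu>) powr (1 / real r)"
      using that pos r by (subst power_mono_iff) auto
    also have "\<dots> \<longleftrightarrow> y \<le> X" using pos by (simp add: X_def field_simps)
    finally show ?thesis .
  qed
  have dens: "gamma_density l k y \<ge> 0" for y
    using pos Gamma_real_pos[of l] by (simp add: gamma_density_def)
  have "emeasure Q {\<omega> \<in> space Q. snr r E \<mu> (Mbar \<omega>) \<le> g} = emeasure Q (Mbar -` A \<inter> space Q)"
    by (rule arg_cong[of _ _ "emeasure Q"]) (auto simp: A_def)
  also have "\<dots> = (\<integral>\<^sup>+y. ennreal (gamma_density l k y) * indicator A y \<partial>lborel)"
    using distributed_emeasure[OF Q A] .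
  also have "\<dots> = (\<integral>\<^sup>+y. ennreal (gamma_density l k y) * indicator {0..X} y \<partial>lborel)"
    by (intro nn_integral_cong) (auto simp: A_def iff indicator_def gamma_density_def)
  also have "\<dots> = ennreal ((X / k) powr l * incgamma_series l (X / k) / Gamma l)"
    using dens X pos by (intro nn_integral_has_integral_lebesgue' gamma_density_integral) auto
  also have "X / k = x" by (simp add: X_def x_def)
  finally have *: "emeasure Q {\<omega> \<in> space Q. snr r E \<mu> (Mbar \<omega>) \<le> g} =
                    ennreal (x powr l * incgamma_series l x / Gamma l)" .
  \<comment> \<open>\<open>ennreal\<close> truncates negative numbers to 0, so nonnegativity has to
    be known before passing to \<open>measure\<close>.\<close>
  have "0 \<le> x powr l * incgamma_series l x / Gamma l"
    using has_integral_nonneg[OF gamma_density_integral[of l k X]] dens X pos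
    by (simp add: X_def x_def)
  with * show ?thesis
    unfolding outage_prob_def by (simp add: measure_def)
qed

lemma incgamma_series_0: "incgamma_series l 0 = 1 / l"
  unfolding incgamma_series_def by (subst powser_zero) simp

section \<open>Evaluation of the G function\<close>

lemma is_pole_Gamma_iff: "is_pole (Gamma :: complex \<Rightarrow> complex) z \<longleftrightarrow> z \<in> \<int>\<^sub>\<le>\<^sub>0"
proof
  assume *: "is_pole Gamma z"
  show "z \<in> \<int>\<^sub>\<le>\<^sub>0"
  proof (rule ccontr)
    assume "z \<notin> \<int>\<^sub>\<le>\<^sub>0"
    hence "\<not> is_pole Gamma z"
      by (intro not_is_pole_holomorphic[of "- \<int>\<^sub>\<le>\<^sub>0"] holomorphic_intros) (auto intro: open_Compl closed_nonpos_Ints)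
    with * show False by contradiction
  qed
qed (auto elim!: nonpos_Ints_cases' intro: is_pole_Gamma)

lemma is_pole_Gamma_add_iff: "is_pole (\<lambda>s::complex. Gamma (c + s)) p \<longleftrightarrow> c + p \<in> \<int>\<^sub>\<le>\<^sub>0"
  using is_pole_shift_iff[of "Gamma :: complex \<Rightarrow> complex" c p] by (simp add: is_pole_Gamma_iff o_def add.commute)

text \<open>The reflection s -> c - s carries punctured neighbourhoods of p to those of c - p, so
  poles are transported.\<close>

lemma is_pole_Gamma_diff_iff: "is_pole (\<lambda>s::complex. Gamma (c - s)) p \<longleftrightarrow> c - p \<in> \<int>\<^sub>\<le>\<^sub>0"
proof -
  have "filtermap (\<lambda>s. c - s) (at p) = at (c - p)"
    by (rule filtermap_fun_inverse[of "\<lambda>s. c - s"])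
       (auto simp: filterlim_at eventually_at_filter algebra_simps intro!: tendsto_eq_intros always_eventually)
  from is_pole_compose_iff[OF this, of Gamma] show ?thesis by (simp add: is_pole_Gamma_iff o_def)
qed

text \<open>The list of the theorem, kept in the same syntactic form so that unfolding recovers the
  stated expression.\<close>

definition lower_params :: "nat \<Rightarrow> real \<Rightarrow> complex list" where
  "lower_params r l =
     (if r = 1 then [0] else [0, (of_nat r - 1) / of_nat r]) @ [- (of_real l / of_nat r)]"

text \<open>For r = 2 the poles of \<Gamma>(s) at -m and of \<Gamma>(s + 1/2) at -m - 1/2 interlace
  into the single family -n/2, with even n from the first and odd n from the second. The right
  family belongs to \<Gamma>(l/r - s).\<close>

lemma meijer_contour_iff:
  assumes "r \<in> {1, 2}"
  shows "meijer_contour r 1 [1 - of_real l / of_nat r] (lower_params r l) L \<longleftrightarrow>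
    upward_contour L \<and> (\<forall>n. left_of L (of_real (- (real n / real r)))) \<and>
    (\<forall>n. right_of L (of_real (l / real r + real n)))"
proof -
  have right: "(\<forall>i<1. \<forall>p. is_pole (\<lambda>s. Gamma (1 - [1 - of_real l / of_nat r] ! i - s)) p \<longrightarrow> right_of L p) \<longleftrightarrow>
    (\<forall>n. right_of L (of_real (l / real r + real n)))"
  proof -
    have "of_real l / of_nat r - p \<in> \<int>\<^sub>\<le>\<^sub>0 \<longleftrightarrow> (\<exists>n. p = of_real (l / real r + real n))" for p :: complex
      by (auto simp: algebra_simps elim!: nonpos_Ints_cases')
    thus ?thesis by (auto simp: is_pole_Gamma_diff_iff)
  qed
  have *: "(\<exists>i<r. lower_params r l ! i + p \<in> \<int>\<^sub>\<le>\<^sub>0) \<longleftrightarrow> (\<exists>n. p = of_real (- (real n / real r)))" for p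
  proof (cases "r = 1")
    case True
    thus ?thesis by (auto simp: lower_params_def elim!: nonpos_Ints_cases')
  next
    case False
    with assms have r: "r = 2" by simp
    have *: "p = of_real (- (real (2 * m) / real r)) \<longleftrightarrow> p = - of_nat m"
         "p = of_real (- (real (2 * m + 1) / real r)) \<longleftrightarrow> 1 / 2 + p = - of_nat m" for m
      using r by (auto simp: field_simps eq_neg_iff_add_eq_0)
    have "(\<exists>i<r. lower_params r l ! i + p \<in> \<int>\<^sub>\<le>\<^sub>0) \<longleftrightarrow> p \<in> \<int>\<^sub>\<le>\<^sub>0 \<or> 1 / 2 + p \<in> \<int>\<^sub>\<le>\<^sub>0"
      using r by (simp add: lower_params_def numeral_2_eq_2 Ex_less_Suc2)
    also have "\<dots> \<longleftrightarrow> (\<exists>m. p = - of_nat m) \<or> (\<exists>m. 1 / 2 + p = - of_nat m)"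
      by (auto elim!: nonpos_Ints_cases')
    also have "\<dots> \<longleftrightarrow> (\<exists>n. p = of_real (- (real n / real r)))"
      unfolding *[symmetric] by (metis evenE oddE)
    finally show ?thesis .
  qed
  have "(\<forall>i<r. \<forall>p. is_pole (\<lambda>s. Gamma (lower_params r l ! i + s)) p \<longrightarrow> left_of L p) \<longleftrightarrow>
    (\<forall>p. (\<exists>i<r. lower_params r l ! i + p \<in> \<int>\<^sub>\<le>\<^sub>0) \<longrightarrow> left_of L p)"
    unfolding is_pole_Gamma_add_iff by blast
  also have "\<dots> \<longleftrightarrow> (\<forall>n. left_of L (of_real (- (real n / real r))))"
    unfolding * by blast
  finally have left: "(\<forall>i<r. \<forall>p. is_pole (\<lambda>s. Gamma (lower_params r l ! i + s)) p \<longrightarrow> left_of L p) \<longleftrightarrow>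
    (\<forall>n. left_of L (of_real (- (real n / real r))))" .
  show ?thesis unfolding meijer_contour_def left right ..
qed

text \<open>With u = l/r - s the quotient \<Gamma>(u)/\<Gamma>(1 + u) collapses to 1/u. For r = 2
  duplication gives 2^(1-2s) sqrt pi \<Gamma>(2s): the constant is 2 sqrt pi, and 2^(-2s) z^(-s) =
  (2 sqrt z)^(-2s) explains the argument 2 sqrt z.\<close>

lemma meijer_integrand_eq:
  assumes "r \<in> {1, 2}" "z > 0" "of_real (l / real r) - s \<notin> \<int>\<^sub>\<le>\<^sub>0"
    "\<And>n. s \<noteq> of_real (- (real n / real r))"
  shows "meijer_integrand r 1 [1 - of_real l / of_nat r] (lower_params r l) (of_real z) s =
     of_real (if r = 1 then 1 else 2 * sqrt pi) *
     mellin_kernel (real r) l (if r = 1 then z else 2 * sqrt z) s"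
proof -
  define u where "u = of_real (l / real r) - s"
  have G: "Gamma u / Gamma (1 + u) = 1 / u"
    using Gamma_plus1[of u] assms(3) by (simp add: u_def add.commute Gamma_eq_zero_iff)
  show ?thesis
  proof (cases "r = 1")
    case True
    have "meijer_integrand r 1 [1 - of_real l / of_nat r] (lower_params r l) (of_real z) s =
            Gamma s * of_real z powr (- s) * (Gamma u / Gamma (1 + u))"
      using True by (simp add: meijer_integrand_def lower_params_def u_def algebra_simps)
    thus ?thesis unfolding G using True by (simp add: mellin_kernel_def u_def)
  next
    case False
    with assms(1) have r: "r = 2" by simp
    have "s \<notin> \<int>\<^sub>\<le>\<^sub>0"
    proof
      assume "s \<in> \<int>\<^sub>\<le>\<^sub>0"
      then obtain n where "s = - of_nat n" by (auto elim: nonpos_Ints_cases')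
      thus False using assms(4)[of "2 * n"] r by simp
    qed
    moreover have "s + 1 / 2 \<notin> \<int>\<^sub>\<le>\<^sub>0"
    proof
      assume "s + 1 / 2 \<in> \<int>\<^sub>\<le>\<^sub>0"
      then obtain n where "s + 1 / 2 = - of_nat n" by (auto elim: nonpos_Ints_cases')
      hence "s = - of_nat n - 1 / 2" by (metis add_diff_cancel_right')
      also have "\<dots> = of_real (- (real (2 * n + 1) / real r))" using r by (simp add: field_simps)
      finally show False using assms(4)[of "2 * n + 1"] by contradiction
    qed
    ultimately have dup: "Gamma s * Gamma (s + 1/2) =
        exp ((1 - 2 * s) * of_real (ln 2)) * of_real (sqrt pi) * Gamma (2 * s)"
      by (rule Gamma_legendre_duplication)
    have "meijer_integrand r 1 [1 - of_real l / of_nat r] (lower_params r l) (of_real z) s =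
            (Gamma s * Gamma (s + 1/2)) * of_real z powr (- s) * (Gamma u / Gamma (1 + u))"
      using r by (simp add: meijer_integrand_def lower_params_def u_def algebra_simps numeral_2_eq_2)
    also have "\<dots> = of_real (2 * sqrt pi) * Gamma (2 * s) *
        (exp (- (2 * s) * of_real (ln 2)) * of_real z powr (- s)) / u"
    proof -
      have "exp ((1 - 2 * s) * of_real (ln 2)) = 2 * exp (- (2 * s) * of_real (ln 2))"
      proof -
        have "(1 - 2 * s) * of_real (ln 2) = of_real (ln 2) + - (2 * s) * of_real (ln 2)"
          by (simp add: algebra_simps)
        hence "exp ((1 - 2 * s) * of_real (ln 2)) = exp (of_real (ln 2)) * exp (- (2 * s) * of_real (ln 2))"
          by (simp only: exp_add)
        also have "exp (complex_of_real (ln 2)) = of_real (exp (ln 2))" by (rule exp_of_real)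
        finally show ?thesis by simp
      qed
      thus ?thesis unfolding dup G by simp
    qed
    also have "exp (- (2 * s) * of_real (ln 2)) * of_real z powr (- s) =
                 of_real (2 * sqrt z) powr (- (2 * s))"
    proof -
      have "ln (2 * sqrt z) = ln 2 + ln z / 2" using assms(2) by (simp add: ln_mult ln_sqrt)
      moreover have "Ln (complex_of_real (2 * sqrt z)) = of_real (ln (2 * sqrt z))"
        using assms(2) by (intro Ln_of_real) auto
      moreover have "Ln (complex_of_real z) = of_real (ln z)"
        using assms(2) by (intro Ln_of_real) auto
      ultimately show ?thesis
        using assms(2) by (simp add: powr_def exp_add[symmetric] algebra_simps del: of_real_mult)
    qed
    finally show ?thesis using r by (simp add: mellin_kernel_def u_def mult_ac)
  qed
qed

lemma meijer_G_eq_incgamma_series: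
  assumes r: "r \<in> {1, 2}" and "z > 0" "l > 0"
  shows "meijer_G r 1 [1 - of_real l / of_nat r] (lower_params r l) (of_real z) =
    of_real ((if r = 1 then 1 else 2 * sqrt pi) * incgamma_series l (if r = 1 then z else 2 * sqrt z))"
proof -
  let ?a = "[1 - complex_of_real l / of_nat r]" and ?b = "lower_params r l"
  define \<kappa> where "\<kappa> = (if r = 1 then 1 else 2 * sqrt pi)"
  define x where "x = (if r = 1 then z else 2 * sqrt z)"
  have "r \<ge> 1" and "x > 0" using assms by (auto simp: x_def)
  \<comment> \<open>Half of l/r: midway between 0, the rightmost left pole, and l/r, the leftmost
    right pole. This line shows that a separating contour exists, so that \<open>SOME\<close>
    returns one.\<close>
  define c where "c = l / real r / 2"
  have c: "c > 0" "l / real r = 2 * c" using assms by (auto simp: c_def)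
  have mc: "meijer_contour r 1 ?a ?b (Complex c)"
    unfolding meijer_contour_iff[OF r] left_of_def right_of_def
  proof safe
    fix n
    have "- (real n / real r) \<le> 0" by simp
    hence "- (real n / real r) < c" using c(1) by (rule le_less_trans)
    thus "index_along (Complex c) (of_real (- (real n / real r))) (1/2)"
      by (intro index_along_Complex_left) (simp only: Re_complex_of_real)
    have "c < l / real r + real n" unfolding c(2) using c(1) by linarith
    thus "index_along (Complex c) (of_real (l / real r + real n)) (-1/2)"
      by (intro index_along_Complex_right) (simp only: Re_complex_of_real)
  qed (rule upward_contour_Complex)
  define L where "L = (SOME L. meijer_contour r 1 ?a ?b L)"
  have "meijer_contour r 1 ?a ?b L"
    unfolding L_def by (rule someI[of "meijer_contour r 1 ?a ?b" "Complex c", OF mc])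
  hence L: "upward_contour L" "\<And>n. left_of L (of_real (- (real n / real r)))"
      "\<And>n. right_of L (of_real (l / real r + real n))"
    unfolding meijer_contour_iff[OF r] by auto
  have "meijer_integrand r 1 ?a ?b (of_real z) (L t) = of_real \<kappa> * mellin_kernel (real r) l x (L t)" for t
    unfolding \<kappa>_def x_def
  proof (rule meijer_integrand_eq[OF r assms(2)])
    show "L t \<noteq> of_real (- (real n / real r))" for n
      using L(2)[of n] unfolding left_of_def index_along_def by (metis rangeI)
    show "of_real (l / real r) - L t \<notin> \<int>\<^sub>\<le>\<^sub>0"
    proof
      assume "of_real (l / real r) - L t \<in> \<int>\<^sub>\<le>\<^sub>0"
      then obtain n where "of_real (l / real r) - L t = - of_nat n" by (auto elim: nonpos_Ints_cases')
      hence "L t = of_real (l / real r + real n)" by (simp add: algebra_simps)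
      moreover have "of_real (l / real r + real n) \<notin> range L"
        using L(3)[of n] unfolding right_of_def index_along_def by blast
      ultimately show False by (metis rangeI)
    qed
  qed
  hence "integral UNIV (\<lambda>t. meijer_integrand r 1 ?a ?b (of_real z) (L t) * vector_derivative L (at t)) =
         of_real \<kappa> * integral UNIV (\<lambda>t. mellin_kernel (real r) l x (L t) * vector_derivative L (at t))"
    by (simp add: mult.assoc)
  also have "integral UNIV (\<lambda>t. mellin_kernel (real r) l x (L t) * vector_derivative L (at t)) =
               2 * of_real pi * \<i> * of_real (incgamma_series l x)"
  proof (rule mellin_kernel_integral)
    show "(\<lambda>n. (-1) ^ n * x ^ n / (fact n * (l + real n))) sums incgamma_series l x"
      using summable_sums[OF summable_incgamma_series[OF assms(3), of x]] by (simp add: incgamma_series_def)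
    show "right_of L (of_real (l / real r))" using L(3)[of 0] by simp
  qed (use L \<open>r \<ge> 1\<close> \<open>x > 0\<close> assms in auto)
  finally have I: "integral UNIV (\<lambda>t. meijer_integrand r 1 ?a ?b (of_real z) (L t) * vector_derivative L (at t)) =
      of_real \<kappa> * (2 * of_real pi * \<i> * of_real (incgamma_series l x))" .
  have cancel: "1 / c * (d * (c * e)) = d * e" if "c \<noteq> 0" for c d e :: complex using that by simp
  show ?thesis
    unfolding meijer_G_def L_def[symmetric] Let_def \<kappa>_def[symmetric] x_def[symmetric] I
    by (subst cancel) auto
qed

text \<open>For r = 2 the factor (2 pi)^(1/2) inside \<open>\<Lambda>3\<close> times sqrt r equals 2
  sqrt pi, which cancels the constant of the duplication formula.\<close>

lemma meijer_prefactor: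
  assumes "r \<in> {1, 2}" and pos: "l > 0" "k > 0" "E > 0" "g > 0" "\<mu> > 0"
  defines "\<Lambda>3 \<equiv> E powr l / (Gamma l * k powr l * (2 * pi) powr ((real r - 1) / 2))"
  shows "\<Lambda>3 / (sqrt (real r) * \<mu> powr (l / real r)) * g powr (l / real r) * (if r = 1 then 1 else 2 * sqrt pi) =
           (E / k * (g / \<mu>) powr (1 / real r)) powr l / Gamma l"
proof -
  have x: "(E / k * (g / \<mu>) powr (1 / real r)) powr l = E powr l / k powr l * (g powr (l / real r) / \<mu> powr (l / real r))"
    using pos by (simp add: powr_mult powr_divide powr_powr)
  show ?thesis
  proof (cases "r = 1")
    case True
    thus ?thesis unfolding x \<Lambda>3_def by simp
  next
    case False
    with assms have r: "r = 2" by simp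
    have "(2 * pi) powr ((real r - 1) / 2) = sqrt 2 * sqrt pi"
      using r by (simp add: powr_half_sqrt real_sqrt_mult)
    moreover have "sqrt 2 * sqrt 2 = (2 :: real)" by simp
    hence "a / (b * c * (sqrt 2 * sqrt pi)) / (sqrt 2 * m) * h * (2 * sqrt pi) = a / c * (h / m) / b" for a b c m h
      by (simp add: field_simps)
    ultimately show ?thesis unfolding x \<Lambda>3_def using r by simp
  qed
qed

section \<open>The high-SNR expression and the conclusion\<close>

lemma Gamma_one_plus_real:
  assumes "x > (0 :: real)" shows "Gamma (1 + x) = x * Gamma x"
proof -
  have "x \<notin> \<int>\<^sub>\<le>\<^sub>0" using assms by (auto elim!: nonpos_Ints_cases)
  from Gamma_plus1[OF this] show ?thesis by (simp add: add.commute)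
qed

text \<open>The term h = 1 is the outage probability with the series replaced by its constant 1/l.
  For r = 2 the term h = 2 carries an extra (g/\<mu>)^(1/2), so it is enough that its coefficient
  does not depend on \<mu>; for r = 1 it is absent and C = 0.\<close>

lemma outage_prob_asymp_eq:
  assumes "r \<in> {1, 2}" and pos: "l > 0" "k > 0" "E > 0" "g > 0" and "\<Lambda>4 > 0"
  defines "\<Lambda>3 \<equiv> E powr l / (Gamma l * k powr l * (2 * pi) powr ((real r - 1) / 2))"
  obtains C where "\<And>\<mu>. \<mu> > 0 \<Longrightarrow> outage_prob_asymp r l \<Lambda>3 \<Lambda>4 g \<mu> =
     (E / k * (g / \<mu>) powr (1 / real r)) powr l / (Gamma l * l) * (1 + C * (g / \<mu>) powr (1 / 2))"
proof -
  have x: "(E / k * (g / \<mu>) powr (1 / real r)) powr l = E powr l / k powr l * (g / \<mu>) powr (l / real r)"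
    if "\<mu> > 0" for \<mu>
    using pos that by (simp add: powr_mult powr_divide powr_powr)
  have Gl: "Gamma l > 0" using pos by (intro Gamma_real_pos)
  show ?thesis
  proof (cases "r = 1")
    case True
    have G: "Gamma (1 + l) = l * Gamma l"
      using pos by (intro Gamma_one_plus_real)
    show ?thesis
    proof (rule that[of 0])
      fix \<mu> :: real assume "\<mu> > 0"
      show "outage_prob_asymp r l \<Lambda>3 \<Lambda>4 g \<mu> =
        (E / k * (g / \<mu>) powr (1 / real r)) powr l / (Gamma l * l) * (1 + 0 * (g / \<mu>) powr (1 / 2))"
        unfolding x[OF \<open>\<mu> > 0\<close>] outage_prob_asymp_def \<Lambda>3_def using True Gl assms \<open>\<mu> > 0\<close>
        by (simp add: t1_def G)
    qed
  next
    case False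
    with assms have r: "r = 2" by simp
    define B where "B = \<Lambda>3 / (sqrt 2 * \<Lambda>4 powr (1 / 2 - 1)) *
        (Gamma (1 / 2 - 1) * Gamma (1 + l / 2 - 1 / 2) / Gamma (1 + (1 + l / 2) - 1 / 2))"
    define A where "A = E powr l / k powr l / (Gamma l * l)"
    have "A > 0" using pos Gl by (simp add: A_def)
    have G: "Gamma (1 + l / 2) = l / 2 * Gamma (l / 2)"
      using pos by (intro Gamma_one_plus_real) simp
    have Gl2: "Gamma (l / 2) > 0" using pos by (intro Gamma_real_pos) auto
    have "(2 * pi) powr (1 / 2) = sqrt 2 * sqrt pi" by (simp add: powr_half_sqrt real_sqrt_mult)
    hence \<Lambda>3: "\<Lambda>3 = E powr l / (Gamma l * k powr l * (sqrt 2 * sqrt pi))"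
      using r by (simp add: \<Lambda>3_def)
    \<comment> \<open>\<Gamma>(1/2) = sqrt pi cancels the sqrt pi in \<open>\<Lambda>3\<close>, the
      two factors sqrt 2 combine to 2, and \<Gamma>(l/2)/\<Gamma>(1 + l/2) = 2/l.\<close>
    have A: "\<Lambda>3 / sqrt 2 * (sqrt pi * Gamma (l / 2) / Gamma (1 + l / 2)) = A"
    proof -
      have "sqrt 2 * sqrt 2 = (2 :: real)" by simp
      thus ?thesis unfolding G \<Lambda>3 A_def using less_imp_neq[OF Gl2, symmetric] pos by (simp add: field_simps)
    qed
    show ?thesis
    proof (rule that[of "B / A"])
      fix \<mu> :: real assume \<mu>: "\<mu> > 0"
      have sum2: "(\<Sum>h=1..2. f h) = f 1 + f 2" for f :: "nat \<Rightarrow> real" by (simp add: numeral_2_eq_2)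
      have diff: "{1..2} - {1} = {2::nat}" "{1..2} - {2} = {1::nat}" by auto
      have t: "t1 2 l 1 = 1" "t1 2 l 2 = 1 / 2" "t1 2 l (2 + 1) = 1 + l / 2" by (simp_all add: t1_def)
      have "outage_prob_asymp r l \<Lambda>3 \<Lambda>4 g \<mu> =
        \<Lambda>3 / sqrt 2 * (g / \<mu>) powr (l / 2) * (sqrt pi * Gamma (l / 2) / Gamma (1 + l / 2)) +
        \<Lambda>3 / (sqrt 2 * \<Lambda>4 powr (1 / 2 - 1)) * (g / \<mu>) powr (l / 2 - 1 / 2 + 1) *
        (Gamma (1 / 2 - 1) * Gamma (1 + l / 2 - 1 / 2) / Gamma (1 + (1 + l / 2) - 1 / 2))"
        unfolding outage_prob_asymp_def r sum2 diff t
        using t assms by (simp add: t Gamma_one_half_real)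
      also have "\<dots> = A * (g / \<mu>) powr (l / 2) + B * (g / \<mu>) powr (l / 2 - 1 / 2 + 1)"
        unfolding A[symmetric] B_def by (simp only: mult_ac times_divide_eq_left times_divide_eq_right)
      also have "(g / \<mu>) powr (l / 2 - 1 / 2 + 1) = (g / \<mu>) powr (l / 2) * (g / \<mu>) powr (1 / 2)"
        by (subst powr_add[symmetric]) (simp add: add.commute)
      also have "A * (g / \<mu>) powr (l / 2) + B * ((g / \<mu>) powr (l / 2) * (g / \<mu>) powr (1 / 2)) =
                 A * (g / \<mu>) powr (l / 2) * (1 + B / A * (g / \<mu>) powr (1 / 2))"
        using \<open>A > 0\<close> by (simp add: field_simps)
      also have "A * (g / \<mu>) powr (l / 2) = (E / k * (g / \<mu>) powr (1 / real r)) powr l / (Gamma l * l)"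
        unfolding x[OF \<mu>] A_def using r by simp
      finally show "outage_prob_asymp r l \<Lambda>3 \<Lambda>4 g \<mu> =
        (E / k * (g / \<mu>) powr (1 / real r)) powr l / (Gamma l * l) * (1 + B / A * (g / \<mu>) powr (1 / 2))" .
    qed
  qed
qed

theorem mainTheorem2:
  fixes P :: "'a measure" and M :: "'a \<Rightarrow> real"
    and Q :: "'b measure" and Mbar :: "'b \<Rightarrow> real"
    and N r :: nat and E V l k \<Lambda>3 \<Lambda>4 g :: real
  assumes "prob_space P" and "M \<in> borel_measurable P" and "AE \<omega> in P. M \<omega> > 0"
    and "integrable P M" and "integrable P (\<lambda>\<omega>. (M \<omega>)\<^sup>2)"
    and "E = prob_space.expectation P M" and "E > 0"
    and "V = prob_space.variance P M" and "V > 0"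
    and "N \<ge> 1" and "r \<in> {1, 2}" and "g > 0"
    and "l = real N * E\<^sup>2 / V" and "k = V / E"
    and "\<Lambda>3 = E powr l / (Gamma l * k powr l * (2 * pi) powr ((real r - 1) / 2))"
    and "\<Lambda>4 = (E / (k * real r)) ^ r"
    and "prob_space Q"
    and "distributed Q lborel Mbar (\<lambda>y. ennreal (gamma_density l k y))"
  shows "(\<forall>\<mu>>0. complex_of_real (outage_prob Q Mbar r E g \<mu>) =
            complex_of_real (\<Lambda>3 / (sqrt (real r) * \<mu> powr (l / real r)) * g powr (l / real r)) *
            meijer_G r 1
              [1 - of_real l / of_nat r]
              ((if r = 1 then [0] else [0, (of_nat r - 1) / of_nat r]) @ [- (of_real l / of_nat r)])
              (of_real (\<Lambda>4 * (g / \<mu>))))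
       \<and> ((\<lambda>\<mu>. outage_prob Q Mbar r E g \<mu> / outage_prob_asymp r l \<Lambda>3 \<Lambda>4 g \<mu>) \<longlongrightarrow> 1) at_top"
proof -
  have pos: "l > 0" "k > 0" "E > 0" "g > 0"
    using assms by simp_all
  have r: "r \<ge> 1" using assms by auto
  have "\<Lambda>4 > 0" using pos r assms by simp
  define x where "x = (\<lambda>\<mu>. E / k * (g / \<mu>) powr (1 / real r))"
  have OP: "outage_prob Q Mbar r E g \<mu> = x \<mu> powr l * incgamma_series l (x \<mu>) / Gamma l" if "\<mu> > 0" for \<mu>
    unfolding x_def using pos r that assms by (intro outage_prob_eq) auto
  have "complex_of_real (outage_prob Q Mbar r E g \<mu>) =
          complex_of_real (\<Lambda>3 / (sqrt (real r) * \<mu> powr (l / real r)) * g powr (l / real r)) *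
          meijer_G r 1 [1 - of_real l / of_nat r] (lower_params r l) (of_real (\<Lambda>4 * (g / \<mu>)))"
    if \<mu>: "\<mu> > 0" for \<mu>
  proof -
    \<comment> \<open>For r = 2, \<open>\<Lambda>4\<close> is (E/(2k))^2, so the factor 2 from
      duplication cancels the 1/2.\<close>
    have arg: "(if r = 1 then \<Lambda>4 * (g / \<mu>) else 2 * sqrt (\<Lambda>4 * (g / \<mu>))) = x \<mu>"
    proof (cases "r = 1")
      case True
      thus ?thesis using pos \<mu> by (simp add: x_def assms(16))
    next
      case False
      with assms have "r = 2" by simp
      moreover have "sqrt ((E / (k * 2))\<^sup>2 * (g / \<mu>)) = E / (k * 2) * sqrt (g / \<mu>)"
        using pos by (subst real_sqrt_mult, subst real_sqrt_abs) simp
      ultimately show ?thesis using pos \<mu> by (simp add: x_def assms(16) powr_half_sqrt)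
    qed
    have "\<Lambda>4 * (g / \<mu>) > 0" using \<open>\<Lambda>4 > 0\<close> pos \<mu> by simp
    from meijer_G_eq_incgamma_series[OF \<open>r \<in> {1, 2}\<close> this \<open>l > 0\<close>]
    have "complex_of_real (\<Lambda>3 / (sqrt (real r) * \<mu> powr (l / real r)) * g powr (l / real r)) *
          meijer_G r 1 [1 - of_real l / of_nat r] (lower_params r l) (of_real (\<Lambda>4 * (g / \<mu>))) =
          of_real ((\<Lambda>3 / (sqrt (real r) * \<mu> powr (l / real r)) * g powr (l / real r) *
            (if r = 1 then 1 else 2 * sqrt pi)) * incgamma_series l (x \<mu>))"
      unfolding arg by (simp only: of_real_mult mult.assoc)
    also have "\<Lambda>3 / (sqrt (real r) * \<mu> powr (l / real r)) * g powr (l / real r) *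
                 (if r = 1 then 1 else 2 * sqrt pi) = x \<mu> powr l / Gamma l"
      using meijer_prefactor[OF \<open>r \<in> {1, 2}\<close> pos \<mu>] unfolding assms(15) x_def .
    also have "x \<mu> powr l / Gamma l * incgamma_series l (x \<mu>) = outage_prob Q Mbar r E g \<mu>"
      using OP[OF \<mu>] by simp
    finally show ?thesis ..
  qed
  moreover have "((\<lambda>\<mu>. outage_prob Q Mbar r E g \<mu> / outage_prob_asymp r l \<Lambda>3 \<Lambda>4 g \<mu>) \<longlongrightarrow> 1) at_top"
  proof -
    obtain C where C: "\<And>\<mu>. \<mu> > 0 \<Longrightarrow> outage_prob_asymp r l \<Lambda>3 \<Lambda>4 g \<mu> =
        x \<mu> powr l / (Gamma l * l) * (1 + C * (g / \<mu>) powr (1 / 2))"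
      using outage_prob_asymp_eq[OF \<open>r \<in> {1, 2}\<close> pos \<open>\<Lambda>4 > 0\<close>] unfolding assms(15) x_def by blast
    have "((\<lambda>\<mu>. g / \<mu>) \<longlongrightarrow> 0) at_top"
      by (rule tendsto_divide_0[OF tendsto_const filterlim_at_top_imp_at_infinity[OF filterlim_ident]])
    moreover have "\<forall>\<^sub>F \<mu> in at_top. 0 \<le> g / \<mu>"
      using eventually_gt_at_top[of 0] by eventually_elim (use pos in simp)
    \<comment> \<open>The base tends to 0, where convergence of the power relies on a nonnegative
      base and a positive exponent.\<close>
    ultimately have pw: "((\<lambda>\<mu>. (g / \<mu>) powr e) \<longlongrightarrow> 0) at_top" if "e > 0" for e
      using tendsto_powr2[of "\<lambda>\<mu>. g / \<mu>" 0 at_top "\<lambda>_. e" e] that by simp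
    have "(x \<longlongrightarrow> E / k * 0) at_top"
      unfolding x_def using r by (intro tendsto_intros pw) auto
    hence "((\<lambda>\<mu>. incgamma_series l (x \<mu>)) \<longlongrightarrow> incgamma_series l 0) at_top"
      by (intro isCont_tendsto_compose[OF isCont_incgamma_series[OF pos(1)]]) simp
    \<comment> \<open>This is the ratio after the common factor x^l / \<Gamma>(l) has been divided
      out.\<close>
    hence "((\<lambda>\<mu>. l * incgamma_series l (x \<mu>) / (1 + C * (g / \<mu>) powr (1 / 2))) \<longlongrightarrow>
              l * incgamma_series l 0 / (1 + C * 0)) at_top"
      by (intro tendsto_intros pw) auto
    also have "l * incgamma_series l 0 / (1 + C * 0) = 1"
      using pos by (simp add: incgamma_series_0)
    finally show ?thesis
    proof (rule Lim_transform_eventually)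
      show "\<forall>\<^sub>F \<mu> in at_top. l * incgamma_series l (x \<mu>) / (1 + C * (g / \<mu>) powr (1 / 2)) =
              outage_prob Q Mbar r E g \<mu> / outage_prob_asymp r l \<Lambda>3 \<Lambda>4 g \<mu>"
        using eventually_gt_at_top[of 0]
      proof eventually_elim
        case (elim \<mu>)
        have "x \<mu> powr l / Gamma l > 0"
          using pos elim Gamma_real_pos[of l] by (simp add: x_def)
        moreover have "l * p / q = (c * p) / (c / l * q)" if "c > 0" for c p q :: real
          using that pos by (simp add: field_simps)
        ultimately have "l * incgamma_series l (x \<mu>) / (1 + C * (g / \<mu>) powr (1 / 2)) =
           (x \<mu> powr l / Gamma l * incgamma_series l (x \<mu>)) /
           (x \<mu> powr l / Gamma l / l * (1 + C * (g / \<mu>) powr (1 / 2)))" by blast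
        thus ?case unfolding OP[OF elim] C[OF elim] by simp
      qed
    qed
  qed
  ultimately show ?thesis unfolding lower_params_def by blast
qed

end
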